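(* Let $w^{AW}$ be the weight system on the lecture hall graph defined, for $0\le j\le i$, by \[ w^{AW}(t;i,j)=\begin{cases}(q^j+q^{-j})/2 & \text{if } t=0,\\ -q^{j-i}/2 & \text{if } t=1,\\ -q^{i-j}/2 & \text{if } t=2,\\ w^{AW,H}(t-3;i,j) & \text{if } t\ge3,\end{cases} \] where, for $m\ge0$, \[ w^{AW,H}(t;i,j)=\frac12(abcd\,q^{2i})^mq^j\times\begin{cases} a & \text{if } t=8m=0,\\ -a^{-1}q^{-i} & \text{if } t=8m\ne0,\\ b & \text{if } t=8m+1,\\ c & \text{if } t=8m+2,\\ -abc\,q^i & \text{if } t=8m+3,\\ d & \text{if } t=8m+4,\\ -abd\,q^i & \text{if } t=8m+5,\\ -acd\,q^i & \text{if } t=8m+6,\\ a^2bcd\,q^{2i} & \text{if } t=8m+7.\end{cases} \] Then for all $n\ge k\ge0$, \[ h^{w^{AW}}_{n,k}=\sigma^{AW}_{n,k}(a,b,c,d;q), \] where $\sigma^{AW}_{n,k}(a,b,c,d;q)$ are the mixed moments of the Askey--Wilson polynomials.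
   Context: Lecture hall graph. For integers $t\ge0$, $0\le j\le i$ put $v^t_{i,j}=(i,\,t+\frac{j}{i+1})$, and set $v^t_{i,i+1}:=v^{t+1}_{i,0}$. The vertices of the lecture hall graph are all $v^t_{i,j}$; its edges join $v^t_{i,j}$ with $v^t_{i,j+1}$ (vertical edges) and $v^t_{i,j}$ with $v^t_{i+1,j}$, for $t\ge 0$, $0\le j\le i$. An east step is a directed edge $(v^t_{i,j},v^t_{i+1,j})$; a south step is a vertical edge directed downwards, $(v^t_{i,j+1},v^t_{i,j})$. A weight system $w$ assigns a weight $w(t;i,j)$ to each east step $(v^t_{i,j},v^t_{i+1,j})$. The weight $w(p)$ of a path is the product of the weights of its east steps. $\mathrm{SE}((k,\infty)\to(n,0))$ is the set of paths $(\dots,v_2,v_1,v_0)$ with $v_0=(n,0)$, $\lim_{m\to\infty}v_m=(k,\infty)$, and each $(v_{m+1},v_m)$ a south or east step. Define $h^w_{n,k}=\sum_{p\in \mathrm{SE}((k,\infty)\to(n,0))}w(p)$ (so $h^w_{n,n}=1$). Askey--Wilson polynomials. The monic Askey--Wilson polynomials are \[ p_n(x;a,b,c,d|q)=\frac{(ab,ac,ad;q)_n}{2^na^n(abcdq^{n-1};q)_n}\;{}_4\phi_3\!\left(\begin{matrix}q^{-n},\,abcdq^{n-1},\,ae^{\mathbf i\theta},\,ae^{-\mathbf i\theta}\\ ab,\,ac,\,ad\end{matrix};q,q\right),\quad x=\cos\theta, \] where $(z;q)_n=\prod_{i=0}^{n-1}(1-zq^i)$, $(z_1,\dots,z_r;q)_n=\prod_s(z_s;q)_n$,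 ${}_{4}\phi_3(\alpha_1,\dots,\alpha_4;\beta_1,\beta_2,\beta_3;q,z)=\sum_{k\ge0}\frac{(\alpha_1,\dots,\alpha_4;q)_k}{(q,\beta_1,\beta_2,\beta_3;q)_k}z^k$. The mixed moments are defined by $x^n=\sum_{k=0}^n\sigma^{AW}_{n,k}(a,b,c,d;q)\,p_k(x;a,b,c,d|q)$. Here $a,b,c,d,q$ are indeterminates and the identity is one of formal power series in $a,b,c,d$ with coefficients in $\mathbb{Q}(q)$. *)

theory Defs
  imports "HOL-Analysis.Analysis" "HOL-Computational_Algebra.Computational_Algebra"
    "HOL-Library.Groups_Big_Fun"
begin

text \<open>
  The power series ring over \<open>\<rat>(q)\<close> in the indeterminates \<open>a, b, c, d\<close> is the iterated ring
  \<open>\<rat>(q)[[a]][[b]][[c]][[d]]\<close> (innermost variable \<open>a\<close>). All quantities live in its field of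
  fractions \<open>aw_coef\<close>, so that the negative powers of \<open>a\<close> in the formulas below can be written
  literally.
\<close>

type_synonym rat_q = "rat poly fract"
type_synonym pow4 = "rat_q fps fps fps fps"
type_synonym aw_coef = "pow4 fract"

definition of_pow4 :: "pow4 \<Rightarrow> aw_coef" where
  "of_pow4 f = Fract f 1"

definition var_a :: aw_coef where
  "var_a = of_pow4 (fps_const (fps_const (fps_const fps_X)))"

definition var_b :: aw_coef where
  "var_b = of_pow4 (fps_const (fps_const fps_X))"

definition var_c :: aw_coef where
  "var_c = of_pow4 (fps_const fps_X)"

definition var_d :: aw_coef where
  "var_d = of_pow4 fps_X"

definition var_q :: aw_coef where
  "var_q = of_pow4 (fps_const (fps_const (fps_const (fps_const (Fract [:0, 1:] 1)))))"

subsection \<open>Sums of families of formal power series\<close>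

definition coeff4 :: "pow4 \<Rightarrow> nat \<times> nat \<times> nat \<times> nat \<Rightarrow> rat_q" where
  "coeff4 f = (\<lambda>(ea, eb, ec, ed). fps_nth (fps_nth (fps_nth (fps_nth f ed) ec) eb) ea)"

text \<open>
  The usual notion of summation in a power series ring: every monomial occurs in only finitely
  many members of the family, and sums are taken coefficientwise. (The library topology on the
  outermost \<^typ>\<open>'a fps\<close> is the \<open>d\<close>-adic one, so it is not used here.)
\<close>

definition has_formal_sum :: "('p \<Rightarrow> aw_coef) \<Rightarrow> 'p set \<Rightarrow> aw_coef \<Rightarrow> bool" where
  "has_formal_sum f A s \<longleftrightarrow>
     (\<exists>g r. (\<forall>x\<in>A. f x = of_pow4 (g x)) \<and> s = of_pow4 r \<and>
        (\<forall>e. finite {x \<in> A. coeff4 (g x) e \<noteq> 0} \<and>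
             coeff4 r e = (\<Sum>x | x \<in> A \<and> coeff4 (g x) e \<noteq> 0. coeff4 (g x) e)))"

definition formally_summable :: "('p \<Rightarrow> aw_coef) \<Rightarrow> 'p set \<Rightarrow> bool" where
  "formally_summable f A \<longleftrightarrow> (\<exists>s. has_formal_sum f A s)"

definition formal_sum :: "('p \<Rightarrow> aw_coef) \<Rightarrow> 'p set \<Rightarrow> aw_coef" where
  "formal_sum f A = (THE s. has_formal_sum f A s)"

subsection \<open>The lecture hall graph\<close>

text \<open>The formula gives \<open>v\<^sup>t\<^sub>i\<^sub>,\<^sub>i\<^sub>+\<^sub>1 = v\<^sup>t\<^sup>+\<^sup>1\<^sub>i\<^sub>,\<^sub>0\<close> without a separate convention.\<close>

definition lh_vertex :: "nat \<Rightarrow> nat \<Rightarrow> nat \<Rightarrow> nat \<times> real" where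
  "lh_vertex t i j = (i, real t + real j / real (i + 1))"

definition east_step :: "nat \<times> real \<Rightarrow> nat \<times> real \<Rightarrow> bool" where
  "east_step u v \<longleftrightarrow> (\<exists>t i j. j \<le> i \<and> u = lh_vertex t i j \<and> v = lh_vertex t (i + 1) j)"

definition south_step :: "nat \<times> real \<Rightarrow> nat \<times> real \<Rightarrow> bool" where
  "south_step u v \<longleftrightarrow> (\<exists>t i j. j \<le> i \<and> u = lh_vertex t i (j + 1) \<and> v = lh_vertex t i j)"

text \<open>
  A path \<open>(\<dots>, v\<^sub>2, v\<^sub>1, v\<^sub>0)\<close> is the sequence \<open>m \<mapsto> v\<^sub>m\<close>, i.e. it is traversed from large to small
  indices.
\<close>

definition SE_paths :: "nat \<Rightarrow> nat \<Rightarrow> (nat \<Rightarrow> nat \<times> real) set" where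
  "SE_paths k n =
     {p. p 0 = (n, 0) \<and>
         (\<forall>m. south_step (p (Suc m)) (p m) \<or> east_step (p (Suc m)) (p m)) \<and>
         (\<lambda>m. fst (p m)) \<longlonglongrightarrow> k \<and>
         filterlim (\<lambda>m. snd (p m)) at_top sequentially}"

text \<open>
  A weight system is a function \<open>w\<close> of which only the values \<open>w t i j\<close> with \<open>j \<le> i\<close> matter. The
  product runs over the set of east steps of the path; no step occurs twice in a path.
\<close>

definition path_weight ::
  "(nat \<Rightarrow> nat \<Rightarrow> nat \<Rightarrow> 'r::comm_monoid_mult) \<Rightarrow> (nat \<Rightarrow> nat \<times> real) \<Rightarrow> 'r" where
  "path_weight w p =
     (\<Prod>(t, i, j) \<in> {(t, i, j). j \<le> i \<and>
         (\<exists>m. p (Suc m) = lh_vertex t i j \<and> p m = lh_vertex t (i + 1) j)}. w t i j)"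

definition lh_h :: "(nat \<Rightarrow> nat \<Rightarrow> nat \<Rightarrow> aw_coef) \<Rightarrow> nat \<Rightarrow> nat \<Rightarrow> aw_coef" where
  "lh_h w n k = formal_sum (path_weight w) (SE_paths k n)"

subsection \<open>Askey--Wilson polynomials and their mixed moments\<close>

definition qpoch :: "'r::comm_ring_1 \<Rightarrow> 'r \<Rightarrow> nat \<Rightarrow> 'r" where
  "qpoch z q n = (\<Prod>i<n. 1 - z * q ^ i)"

definition qpochs :: "'r::comm_ring_1 list \<Rightarrow> 'r \<Rightarrow> nat \<Rightarrow> 'r" where
  "qpochs zs q n = (\<Prod>z\<leftarrow>zs. qpoch z q n)"

text \<open>
  \<^const>\<open>Sum_any\<close> is the sum over the finitely many nonzero terms; the series is used only when
  it terminates.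
\<close>

definition phi43 :: "'r::field list \<Rightarrow> 'r list \<Rightarrow> 'r \<Rightarrow> 'r \<Rightarrow> 'r" where
  "phi43 \<alpha>s \<beta>s q z = Sum_any (\<lambda>k::nat. qpochs \<alpha>s q k / qpochs (q # \<beta>s) q k * z ^ k)"

text \<open>The value \<open>p\<^sub>n(x; a, b, c, d | q)\<close> at \<open>x = (e + e\<inverse>) / 2\<close>, where \<open>e\<close> stands for \<open>e\<^sup>i\<^sup>\<theta>\<close>.\<close>

definition askey_wilson ::
  "nat \<Rightarrow> 'r::field \<Rightarrow> 'r \<Rightarrow> 'r \<Rightarrow> 'r \<Rightarrow> 'r \<Rightarrow> 'r \<Rightarrow> 'r" where
  "askey_wilson n e a b c d q =
     qpochs [a * b, a * c, a * d] q n /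
       (2 ^ n * a ^ n * qpoch (a * b * c * d * q powi (int n - 1)) q n) *
     phi43 [q powi (- int n), a * b * c * d * q powi (int n - 1), a * e, a * inverse e]
       [a * b, a * c, a * d] q q"

text \<open>
  To make \<open>x = cos \<theta>\<close> an indeterminate, \<open>e\<^sup>i\<^sup>\<theta>\<close> is taken to be the generator of the rational
  function field over \<^typ>\<open>aw_coef\<close>; then \<open>x\<close> is transcendental over \<^typ>\<open>aw_coef\<close>.
\<close>

type_synonym aw_fun = "aw_coef poly fract"

definition of_coef :: "aw_coef \<Rightarrow> aw_fun" where
  "of_coef r = Fract [:r:] 1"

definition exp_theta :: aw_fun where
  "exp_theta = Fract [:0, 1:] 1"

definition cos_theta :: aw_fun where
  "cos_theta = (exp_theta + inverse exp_theta) / 2"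

definition AW :: "nat \<Rightarrow> aw_coef \<Rightarrow> aw_coef \<Rightarrow> aw_coef \<Rightarrow> aw_coef \<Rightarrow> aw_coef \<Rightarrow> aw_fun" where
  "AW n a b c d q =
     askey_wilson n exp_theta (of_coef a) (of_coef b) (of_coef c) (of_coef d) (of_coef q)"

text \<open>
  Row \<open>n\<close> of the mixed moments consists of the coordinates of \<open>x\<^sup>n\<close> with respect to
  \<open>p\<^sub>0, \<dots>, p\<^sub>n\<close>, extended by \<open>0\<close> beyond \<open>k = n\<close>. Since \<open>p\<^sub>k\<close> is monic of degree \<open>k\<close> in \<open>x\<close>, the
  row exists and is unique for indeterminate parameters.
\<close>

definition sigma_AW ::
  "nat \<Rightarrow> nat \<Rightarrow> aw_coef \<Rightarrow> aw_coef \<Rightarrow> aw_coef \<Rightarrow> aw_coef \<Rightarrow> aw_coef \<Rightarrow> aw_coef" where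
  "sigma_AW n k a b c d q =
     (THE s. (\<forall>j>n. s j = 0) \<and>
        cos_theta ^ n = (\<Sum>j\<le>n. of_coef (s j) * AW j a b c d q)) k"

subsection \<open>The weight systems\<close>

definition w_AWH ::
  "'r::field \<Rightarrow> 'r \<Rightarrow> 'r \<Rightarrow> 'r \<Rightarrow> 'r \<Rightarrow> nat \<Rightarrow> nat \<Rightarrow> nat \<Rightarrow> 'r" where
  "w_AWH a b c d q t i j =
     (let m = t div 8 in
      1 / 2 * (a * b * c * d * q ^ (2 * i)) ^ m * q ^ j *
      (if t = 8 * m \<and> m = 0 then a
       else if t = 8 * m then - inverse a * q powi (- int i)
       else if t = 8 * m + 1 then b
       else if t = 8 * m + 2 then c
       else if t = 8 * m + 3 then - a * b * c * q ^ i
       else if t = 8 * m + 4 then d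
       else if t = 8 * m + 5 then - a * b * d * q ^ i
       else if t = 8 * m + 6 then - a * c * d * q ^ i
       else a ^ 2 * b * c * d * q ^ (2 * i)))"

definition w_AW ::
  "'r::field \<Rightarrow> 'r \<Rightarrow> 'r \<Rightarrow> 'r \<Rightarrow> 'r \<Rightarrow> nat \<Rightarrow> nat \<Rightarrow> nat \<Rightarrow> 'r" where
  "w_AW a b c d q t i j =
     (if t = 0 then (q ^ j + q powi (- int j)) / 2
      else if t = 1 then - (q powi (int j - int i)) / 2
      else if t = 2 then - (q powi (int i - int j)) / 2
      else w_AWH a b c d q (t - 3) i j)"

end

theory Submission
  imports Defs
begin

text \<open>
  Reading a path level by level turns \<open>h\<^sub>n\<^sub>,\<^sub>k\<close> into an entry of an infinite product
  \<open>G\<^sub>0 G\<^sub>1 G\<^sub>2 \<dots>\<close> of lower triangular matrices, where \<open>G\<^sub>t\<close> collects the east steps at the heights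
  in \<open>[t, t + 1)\<close>. A weight of the form \<open>f(i) q\<^sup>j\<close> gives the matrix \<open>qbm q f\<close> with entries
  \<open>qbin q n k * f(k) \<cdots> f(n - 1)\<close>, and the q-binomial theorem becomes the factorization
  \<open>qbm q (g(i) (1 - x q\<^sup>i)) = qbm q g * qbm q (- x q\<^sup>i g(i))\<close>.

  Let \<open>\<phi>\<^sub>k = \<Prod>\<^sub>i\<^sub><\<^sub>k (x - (a q\<^sup>i + a\<^sup>-\<^sup>1 q\<^sup>-\<^sup>i) / 2)\<close> and \<open>s = a b c d\<close>. The expansion of the Askey--Wilson
  polynomials in the \<open>\<phi>\<^sub>k\<close> has an explicit inverse \<open>Z\<^sub>0\<close>, so that the mixed moments are \<open>C(a) Z\<^sub>0\<close>,
  where \<open>C(a)\<close> expands \<open>x\<^sup>n\<close> in the \<open>\<phi>\<^sub>k\<close>. A Durfee-type identity gives \<open>Z\<^sub>m = qbm q f\<^sub>m * Z\<^sub>m\<^sub>+\<^sub>1\<close>,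
  where \<open>f\<^sub>m\<close> is \<open>f\<^sub>0\<close> times \<open>(s q\<^sup>2\<^sup>i)\<^sup>m\<close>, and \<open>qbm q f\<^sub>m\<close> factors into the eight level matrices of one period.
  The first factor of \<open>qbm q f\<^sub>0\<close> does not occur in the graph, but \<open>C(a)\<close> times this factor is
  \<open>G\<^sub>0 G\<^sub>1 G\<^sub>2 G\<^sub>3\<close>, because both sides expand \<open>x\<^sup>n\<close> in the Askey--Wilson polynomials with parameters
  \<open>(a, 0, 0, 0)\<close>. Finally \<open>Z\<^sub>m\<close> tends to the identity matrix d-adically.
\<close>

subsection \<open>q-binomial coefficients\<close>

lemma qpoch_0 [simp]: "qpoch z q 0 = 1"
  by (simp add: qpoch_def)

lemma qpoch_Suc: "qpoch z q (Suc n) = qpoch z q n * (1 - z * q ^ n)"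
  by (simp add: qpoch_def)

lemma qpoch_add: "qpoch z q (m + n) = qpoch z q m * qpoch (z * q ^ m) q n"
  by (induction n) (simp_all add: qpoch_Suc power_add mult_ac)

lemma qpoch_Suc_left: "qpoch z q (Suc n) = (1 - z) * qpoch (z * q) q n"
  using qpoch_add[of z q 1 n] by (simp add: qpoch_Suc)

lemma qpoch_nonzero:
  fixes z q :: "'a::idom"
  shows "(\<And>i. i < n \<Longrightarrow> z * q ^ i \<noteq> 1) \<Longrightarrow> qpoch z q n \<noteq> 0"
  by (auto simp: qpoch_def)

text \<open>The Gaussian binomial coefficient, encoded by its Pascal recurrence so that no division
  occurs: it makes sense over every commutative ring, and its integrality is immediate.\<close>

fun qbin :: "'a::comm_ring_1 \<Rightarrow> nat \<Rightarrow> nat \<Rightarrow> 'a" where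
  "qbin q n 0 = 1"
| "qbin q 0 (Suc k) = 0"
| "qbin q (Suc n) (Suc k) = qbin q n k + q ^ Suc k * qbin q n (Suc k)"

lemma qbin_eq_0: "n < k \<Longrightarrow> qbin q n k = 0"
  by (induction q n k rule: qbin.induct) auto

lemma qbin_same [simp]: "qbin q n n = 1"
  by (induction n) (auto simp: qbin_eq_0)

text \<open>The q-factorial formula with denominators cleared, as they may vanish at roots of unity.
  In the induction the two Pascal summands contribute 1 - q^(k+1) and q^(k+1) (1 - q^(n-k)), which
  add up to 1 - q^(n+1).\<close>

lemma qbin_mult_qpoch:
  "k \<le> n \<Longrightarrow> qbin q n k * (qpoch q q k * qpoch q q (n - k)) = qpoch q q n"
proof (induction q n k rule: qbin.induct)
  case (3 q n k)
  show ?case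
  proof (cases "k = n")
    case False
    then obtain d where d: "n = Suc k + d"
      using 3(3) by (metis Suc_leI Suc_le_mono le_Suc_ex nat_less_le)
    have 1: "qbin q n k * (qpoch q q k * qpoch q q (Suc d)) = qpoch q q n"
      and 2: "qbin q n (Suc k) * (qpoch q q (Suc k) * qpoch q q d) = qpoch q q n"
      using 3(1,2) d by simp_all
    have "qbin q (Suc n) (Suc k) * (qpoch q q (Suc k) * qpoch q q (Suc n - Suc k)) =
        qbin q n k * (qpoch q q k * qpoch q q (Suc d)) * (1 - q ^ Suc k) +
        q ^ Suc k * (1 - q ^ Suc d) * (qbin q n (Suc k) * (qpoch q q (Suc k) * qpoch q q d))"
      using d by (simp add: qpoch_Suc algebra_simps del: qbin.simps(1,2))
    also have "\<dots> = qpoch q q n * (1 - q ^ Suc k) + q ^ Suc k * (1 - q ^ Suc d) * qpoch q q n"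
      unfolding 1 2 ..
    also have "\<dots> = qpoch q q (Suc n)"
      unfolding d by (simp add: qpoch_Suc algebra_simps power_add)
    finally show ?thesis .
  qed (simp add: qbin_eq_0)
qed auto

text \<open>The product over i < r is (-z)^r q^(r(r-1)/2). By the Pascal rule the sum for N + 1 at z
  is the sum for N at z q taken with the factors 1 and -z, which is why z is generalized.\<close>

lemma q_binomial_theorem:
  "(\<Sum>r\<le>N. qbin q N r * (\<Prod>i<r. - (z * q ^ i))) = qpoch z q N"
proof (induction N arbitrary: z)
  case (Suc N)
  let ?P = "\<lambda>z r. \<Prod>i<r. - (z * q ^ i)"
  have P_q: "q ^ r * ?P z r = ?P (z * q) r" for r
    by (induction r) (simp_all add: algebra_simps)
  have P_Suc: "?P z (Suc r) = - z * ?P (z * q) r" for r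
    unfolding prod.lessThan_Suc_shift by (simp add: mult_ac)
  have "(\<Sum>r\<le>Suc N. qbin q (Suc N) r * ?P z r) =
      1 + (\<Sum>r\<le>N. q ^ Suc r * qbin q N (Suc r) * ?P z (Suc r)) +
      (\<Sum>r\<le>N. qbin q N r * ?P z (Suc r))"
    by (subst sum.atMost_Suc_shift) (simp add: sum.distrib algebra_simps del: prod.lessThan_Suc)
  also have "1 + (\<Sum>r\<le>N. q ^ Suc r * qbin q N (Suc r) * ?P z (Suc r)) =
      (\<Sum>r\<le>Suc N. q ^ r * qbin q N r * ?P z r)"
    by (subst sum.atMost_Suc_shift) simp
  also have "\<dots> = (\<Sum>r\<le>N. qbin q N r * ?P (z * q) r)"
    by (simp add: qbin_eq_0 P_q[symmetric]) (simp add: mult_ac)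
  also have "\<dots> = qpoch (z * q) q N"
    by (rule Suc.IH)
  also have "(\<Sum>r\<le>N. qbin q N r * ?P z (Suc r)) = - z * qpoch (z * q) q N"
    unfolding P_Suc Suc.IH[symmetric] by (simp add: sum_distrib_left mult_ac)
  finally show ?case
    by (simp add: qpoch_Suc_left algebra_simps)
qed simp

locale q_generic =
  fixes q :: "'a::field"
  assumes q_nonzero [simp]: "q \<noteq> 0"
    and not_root_of_unity: "n > 0 \<Longrightarrow> q ^ n \<noteq> 1"
begin

lemma one_minus_power_nonzero [simp]: "1 - q ^ Suc n \<noteq> 0"
  using not_root_of_unity[of "Suc n"] by (simp del: power_Suc)

lemma qpoch_q_nonzero [simp]: "qpoch q q n \<noteq> 0"
  by (rule qpoch_nonzero) (metis not_root_of_unity power_Suc zero_less_Suc)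

lemma qbin_conv_qpoch: "qbin q (k + r) k = qpoch q q (k + r) / (qpoch q q k * qpoch q q r)"
  using qbin_mult_qpoch[of k "k + r" q] by (simp add: field_simps)

lemma qbin_symmetric: "qbin q (k + r) k = qbin q (k + r) r"
  using qbin_conv_qpoch[of k r] qbin_conv_qpoch[of r k] by (simp add: add_ac)

text \<open>Both sides are the q-multinomial coefficient of k, r and N - r. In matrix products this
  pulls a q-binomial out of the sum over the middle index.\<close>

lemma qbin_trinomial:
  "r \<le> N \<Longrightarrow> qbin q (k + N) (k + r) * qbin q (k + r) k = qbin q (k + N) k * qbin q N r"
  using qbin_conv_qpoch[of "k + r" "N - r"] qbin_conv_qpoch[of k r] qbin_conv_qpoch[of k N]
    qbin_conv_qpoch[of r "N - r"]
  by simp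

lemma qbin_Suc_right: "r \<le> N \<Longrightarrow> qbin q N (Suc r) * (1 - q ^ Suc r) = qbin q N r * (1 - q ^ (N - r))"
proof (cases "r = N")
  case False
  assume "r \<le> N"
  with False obtain d where d: "N = Suc r + d"
    by (metis less_iff_Suc_add add_Suc nat_less_le)
  define u v where "u = 1 - q ^ Suc r" and "v = 1 - q ^ Suc d"
  have "u \<noteq> 0" "v \<noteq> 0"
    unfolding u_def v_def by (rule one_minus_power_nonzero)+
  moreover have "qpoch q q (Suc r) = qpoch q q r * u" "qpoch q q (Suc d) = qpoch q q d * v"
    by (simp_all add: qpoch_Suc u_def v_def)
  ultimately have "qbin q N (Suc r) * u = qbin q N r * v"
    using qbin_conv_qpoch[of "Suc r" d] qbin_conv_qpoch[of r "Suc d"] by (simp add: d del: qbin.simps)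
  then show ?thesis
    by (simp add: u_def v_def d)
qed (simp add: qbin_eq_0)

lemma qbin_Suc_Suc: "r \<le> N \<Longrightarrow> qbin q (Suc N) (Suc r) * (1 - q ^ Suc r) = qbin q N r * (1 - q ^ Suc N)"
proof -
  assume r: "r \<le> N"
  have "qbin q (Suc N) (Suc r) * (1 - q ^ Suc r) =
      qbin q N r * (1 - q ^ Suc r) + q ^ Suc r * (qbin q N (Suc r) * (1 - q ^ Suc r))"
    by (simp add: algebra_simps)
  also have "\<dots> = qbin q N r * (1 - q ^ Suc r + q ^ Suc r * (1 - q ^ (N - r)))"
    unfolding qbin_Suc_right[OF r] by (simp add: algebra_simps)
  also have "1 - q ^ Suc r + q ^ Suc r * (1 - q ^ (N - r)) = 1 - q ^ Suc N"
    using power_add[of q "Suc r" "N - r"] r by (simp add: algebra_simps)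
  finally show ?thesis .
qed

lemma qbin_pascal': "r \<le> N \<Longrightarrow> qbin q (Suc N) (Suc r) = q ^ (N - r) * qbin q N r + qbin q N (Suc r)"
  using qbin_Suc_right[of r N] by (simp add: algebra_simps)

section \<open>Two terminating q-series identities\<close>

text \<open>Divided by (z;q)_N this is Cauchy's expansion of 1/(z;q)_N, with terms
  \<open>qbin q N r\<close> z^r q^(r(r-1)) / (z;q)_r. The second Pascal rule splits the sum for N +
  1 into 1 - z q^N times the sum for N at z, and z q^N times the sum for N at z q.\<close>

lemma durfee_sum:
  "(\<Sum>r\<le>N. qbin q N r * (\<Prod>i<r. z * q ^ (2 * i)) * qpoch (z * q ^ r) q (N - r)) = 1"
proof (induction N arbitrary: z)
  case (Suc N)
  let ?P = "\<lambda>z r. \<Prod>i<r. z * q ^ (2 * i)"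
  have P_Suc: "?P z (Suc r) = z * q ^ r * ?P (z * q) r" for r
    by (induction r) (simp_all add: algebra_simps power_add)
  have "(\<Sum>r\<le>Suc N. qbin q (Suc N) r * ?P z r * qpoch (z * q ^ r) q (Suc N - r)) =
     qpoch z q (Suc N) +
     (\<Sum>r\<le>N. qbin q (Suc N) (Suc r) * ?P z (Suc r) * qpoch (z * q ^ Suc r) q (N - r))"
    by (subst sum.atMost_Suc_shift) simp
  also have "\<dots> = qpoch z q (Suc N) +
     (\<Sum>r\<le>N. qbin q N (Suc r) * ?P z (Suc r) * qpoch (z * q ^ Suc r) q (N - r)) +
     (\<Sum>r\<le>N. q ^ (N - r) * qbin q N r * ?P z (Suc r) * qpoch (z * q ^ Suc r) q (N - r))"
    unfolding add.assoc sum.distrib[symmetric]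
    by (intro arg_cong2[of _ _ _ _ "(+)"] sum.cong refl)
       (simp add: qbin_pascal' algebra_simps del: qbin.simps prod.lessThan_Suc)
  also have "(\<Sum>r\<le>N. q ^ (N - r) * qbin q N r * ?P z (Suc r) * qpoch (z * q ^ Suc r) q (N - r)) =
      (\<Sum>r\<le>N. z * q ^ N * (qbin q N r * ?P (z * q) r * qpoch (z * q * q ^ r) q (N - r)))"
  proof (intro sum.cong refl)
    fix r assume "r \<in> {..N}"
    then have "q ^ N = q ^ (N - r) * q ^ r"
      by (simp flip: power_add)
    then show "q ^ (N - r) * qbin q N r * ?P z (Suc r) * qpoch (z * q ^ Suc r) q (N - r) =
        z * q ^ N * (qbin q N r * ?P (z * q) r * qpoch (z * q * q ^ r) q (N - r))"
      unfolding P_Suc by (simp add: mult_ac)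
  qed
  also have "\<dots> = z * q ^ N"
    unfolding sum_distrib_left[symmetric] Suc.IH by simp
  also have "qpoch z q (Suc N) +
     (\<Sum>r\<le>N. qbin q N (Suc r) * ?P z (Suc r) * qpoch (z * q ^ Suc r) q (N - r)) =
     (\<Sum>r\<le>Suc N. qbin q N r * ?P z r * qpoch (z * q ^ r) q (Suc N - r))"
    by (subst sum.atMost_Suc_shift) simp
  also have "\<dots> = (\<Sum>r\<le>N. (1 - z * q ^ N) * (qbin q N r * ?P z r * qpoch (z * q ^ r) q (N - r)))"
  proof -
    have *: "qpoch (z * q ^ r) q (Suc N - r) = (1 - z * q ^ N) * qpoch (z * q ^ r) q (N - r)"
      if "r \<le> N" for r
      using that by (simp add: Suc_diff_le qpoch_Suc power_add[symmetric] mult.assoc)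
    show ?thesis
      by (simp add: qbin_eq_0) (auto intro!: sum.cong simp: * mult_ac)
  qed
  also have "\<dots> = 1 - z * q ^ N"
    unfolding sum_distrib_left[symmetric] Suc.IH by simp
  finally show ?case by simp
qed simp

text \<open>The closed form of the partial sums makes the sum telescope; at R = M + 1 its factor
  \<open>qbin q M R\<close> vanishes, which gives \<open>orthogonality_sum\<close>. Only positive
  powers of q are excluded as values of 1/y: at r = 0 the second denominator is an empty product, so
  y = 1 is allowed.\<close>

lemma orthogonality_partial_sum:
  assumes y: "\<And>i. y * q ^ Suc i \<noteq> 1" and "R \<le> Suc M"
  shows "(\<Sum>r\<le>R. qbin q (Suc M) r * (\<Prod>i<r. - (q ^ i)) /
             (qpoch (y * q ^ Suc (2 * r)) q (Suc M - r) * qpoch (y * q ^ r) q r)) =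
         (\<Prod>i<R. - (q ^ Suc i)) * qbin q M R / qpoch (y * q ^ Suc R) q (Suc M)"
  using assms(2)
proof (induction R)
  case (Suc R)
  then have R: "R \<le> M" by simp
  have nz: "qpoch (y * q ^ Suc j) q m \<noteq> 0" for j m
    by (rule qpoch_nonzero) (metis y add_Suc mult.assoc power_add)
  \<comment> \<open>A common denominator: the old closed form, the new one and the new summand each
    lack exactly one factor of D (\<open>D1\<close>, \<open>D2\<close>, \<open>D3\<close>). What
    remains is the identity \<open>t3\<close>, a consequence of the Pascal rule and
    \<open>qbin_Suc_right\<close>.\<close>
  define D where "D = qpoch (y * q ^ Suc R) q (Suc (Suc M))"
  define P where "P = (\<Prod>i<R. - (q ^ Suc i))"
  have "D \<noteq> 0" unfolding D_def by (rule nz)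
  have D1: "D = qpoch (y * q ^ Suc R) q (Suc M) * (1 - y * q ^ (R + M + 2))"
    by (simp add: D_def qpoch_Suc[of _ _ "Suc M"] power_add mult_ac)
  have D2: "D = (1 - y * q ^ Suc R) * qpoch (y * q ^ Suc (Suc R)) q (Suc M)"
    unfolding D_def by (subst qpoch_Suc_left) (simp add: mult_ac)
  have q2: "q ^ (R * 2) = q ^ R * q ^ R"
    by (simp add: mult_2_right power_add)
  have "D = qpoch (y * q ^ Suc R) q (Suc R + Suc (M - R))"
    using R by (simp add: D_def)
  also have "\<dots> = qpoch (y * q ^ Suc R) q (Suc R) * ((1 - y * q ^ (2 * R + 2)) *
      qpoch (y * q ^ Suc (2 * Suc R)) q (M - R))"
    unfolding qpoch_add qpoch_Suc_left[of _ _ "M - R"]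
    by (simp add: power_add q2 mult_ac)
  finally have D3: "D = qpoch (y * q ^ Suc R) q (Suc R) * ((1 - y * q ^ (2 * R + 2)) *
      qpoch (y * q ^ Suc (2 * Suc R)) q (M - R))" .
  have f: "1 - y * q ^ (R + M + 2) \<noteq> 0" "1 - y * q ^ Suc R \<noteq> 0" "1 - y * q ^ (2 * R + 2) \<noteq> 0"
    using \<open>D \<noteq> 0\<close> D1 D2 D3 by auto
  have "(\<Prod>i<Suc R. - (q ^ i)) = - P"
    unfolding P_def prod.lessThan_Suc_shift by simp
  then have t1: "qbin q (Suc M) (Suc R) * (\<Prod>i<Suc R. - (q ^ i)) /
      (qpoch (y * q ^ Suc (2 * Suc R)) q (Suc M - Suc R) * qpoch (y * q ^ Suc R) q (Suc R)) =
      qbin q (Suc M) (Suc R) * - P * (1 - y * q ^ (2 * R + 2)) / D"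
    using \<open>D \<noteq> 0\<close> f unfolding D3 by (simp add: field_simps del: qbin.simps power_Suc mult_Suc_right)
  have t2: "P * qbin q M R / qpoch (y * q ^ Suc R) q (Suc M) =
      P * qbin q M R * (1 - y * q ^ (R + M + 2)) / D"
    using \<open>D \<noteq> 0\<close> f unfolding D1 by (simp add: field_simps del: power_Suc)
  have t3: "qbin q M R * (1 - y * q ^ (R + M + 2)) -
      qbin q (Suc M) (Suc R) * (1 - y * q ^ (2 * R + 2)) =
      - (q ^ Suc R) * qbin q M (Suc R) * (1 - y * q ^ Suc R)"
  proof -
    have "q ^ (R + M + 2) = q ^ (2 * R + 2) * q ^ (M - R)"
      using R by (simp flip: power_add)
    then have "qbin q M R * (1 - y * q ^ (R + M + 2)) -
      qbin q (Suc M) (Suc R) * (1 - y * q ^ (2 * R + 2)) =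
      y * q ^ (2 * R + 2) * (qbin q M R * (1 - q ^ (M - R))) -
      q ^ Suc R * qbin q M (Suc R) * (1 - y * q ^ (2 * R + 2))"
      by (simp add: algebra_simps)
    also have "qbin q M R * (1 - q ^ (M - R)) = qbin q M (Suc R) * (1 - q ^ Suc R)"
      using qbin_Suc_right[OF R] by simp
    finally show ?thesis
      by (simp add: algebra_simps power_add q2)
  qed
  have "(\<Sum>r\<le>Suc R. qbin q (Suc M) r * (\<Prod>i<r. - (q ^ i)) /
             (qpoch (y * q ^ Suc (2 * r)) q (Suc M - r) * qpoch (y * q ^ r) q r)) =
      P * (qbin q M R * (1 - y * q ^ (R + M + 2)) -
        qbin q (Suc M) (Suc R) * (1 - y * q ^ (2 * R + 2))) / D"
    unfolding sum.atMost_Suc Suc.IH[OF Suc_leD[OF Suc.prems]] P_def[symmetric] t1 t2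
      add_divide_distrib[symmetric]
    by (rule arg_cong[of _ _ "\<lambda>x. x / D"]) (simp add: algebra_simps del: qbin.simps)
  then show ?case
    unfolding t3 unfolding D2
    using f by (simp add: P_def[symmetric] mult_ac del: qbin.simps power_Suc mult_Suc_right)
qed simp

lemma orthogonality_sum:
  assumes "\<And>i. y * q ^ Suc i \<noteq> 1" and "N > 0"
  shows "(\<Sum>r\<le>N. qbin q N r * (\<Prod>i<r. - (q ^ i)) /
             (qpoch (y * q ^ Suc (2 * r)) q (N - r) * qpoch (y * q ^ r) q r)) = 0"
  using orthogonality_partial_sum[of y "N" "N - 1"] assms by (simp add: qbin_eq_0)

end

subsection \<open>Lower triangular matrices\<close>

text \<open>Triangularity makes all sums in a product of infinite matrices finite, so that these
  matrices form a monoid and factorizations can be handled by plain associativity.\<close>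

typedef (overloaded) 'a ltri = "{M :: nat \<Rightarrow> nat \<Rightarrow> 'a::zero. \<forall>n k. n < k \<longrightarrow> M n k = 0}"
  morphisms entry Abs_ltri by auto

setup_lifting type_definition_ltri

lemma entry_eq_0: "n < k \<Longrightarrow> entry M n k = 0"
  using entry by auto

lemma ltri_eqI: "(\<And>n k. k \<le> n \<Longrightarrow> entry M n k = entry N n k) \<Longrightarrow> M = N"
  by (metis entry_inject entry_eq_0 ext not_le)

instantiation ltri :: (comm_semiring_1) monoid_mult
begin

lift_definition one_ltri :: "'a ltri" is "\<lambda>n k. if n = k then 1 else 0"
  by auto

lift_definition times_ltri :: "'a ltri \<Rightarrow> 'a ltri \<Rightarrow> 'a ltri" is
  "\<lambda>M N n k. \<Sum>j\<le>n. M n j * N j k"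
  by (auto intro!: sum.neutral)

instance
proof
  fix A B C :: "'a ltri"
  show "A * B * C = A * (B * C)"
  proof (rule ltri_eqI)
    fix n k
    have "entry (A * B * C) n k = (\<Sum>j\<le>n. \<Sum>i\<le>n. entry A n i * entry B i j * entry C j k)"
      by (simp add: times_ltri.rep_eq sum_distrib_right)
    also have "\<dots> = (\<Sum>i\<le>n. \<Sum>j\<le>n. entry A n i * entry B i j * entry C j k)"
      by (rule sum.swap)
    also have "\<dots> = (\<Sum>i\<le>n. \<Sum>j\<le>i. entry A n i * entry B i j * entry C j k)"
      by (intro sum.cong refl sum.mono_neutral_right) (auto simp: entry_eq_0)
    also have "\<dots> = entry (A * (B * C)) n k"
      by (simp add: times_ltri.rep_eq sum_distrib_left mult.assoc)
    finally show "entry (A * B * C) n k = entry (A * (B * C)) n k" .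
  qed
  show "1 * A = A"
    by (rule ltri_eqI) (simp add: times_ltri.rep_eq one_ltri.rep_eq if_distrib[of "\<lambda>x. x * _"] cong: if_cong)
  show "A * 1 = A"
    by (rule ltri_eqI) (simp add: times_ltri.rep_eq one_ltri.rep_eq if_distrib[of "\<lambda>x. _ * x"] cong: if_cong)
qed

end

lemma entry_mult: "entry (M * N) n k = (\<Sum>j\<le>n. entry M n j * entry N j k)"
  by (simp add: times_ltri.rep_eq)

lemma entry_mult_shift:
  "entry (M * N) (k + m) k = (\<Sum>r\<le>m. entry M (k + m) (k + r) * entry N (k + r) k)"
proof -
  have "entry (M * N) (k + m) k = (\<Sum>j\<in>{k..k + m}. entry M (k + m) j * entry N j k)"
    unfolding entry_mult by (rule sum.mono_neutral_right) (auto simp: entry_eq_0)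
  also have "\<dots> = (\<Sum>r\<le>m. entry M (k + m) (k + r) * entry N (k + r) k)"
    by (rule sum.reindex_bij_witness[of _ "\<lambda>r. k + r" "\<lambda>j. j - k"]) auto
  finally show ?thesis .
qed

lemma ltri_eqI_shift: "(\<And>k m. entry M (k + m) k = entry N (k + m) k) \<Longrightarrow> M = N"
  by (rule ltri_eqI) (metis le_Suc_ex)

lemma entry_one: "entry 1 n k = (if n = k then 1 else 0)"
  by (simp add: one_ltri.rep_eq)

subsection \<open>Three-term recurrences\<close>

text \<open>
  Row \<open>n\<close> contains the coordinates of \<open>x\<^sup>n\<close> with respect to the monic polynomials \<open>p\<^sub>k\<close> with
  \<open>x p\<^sub>k = p\<^sub>k\<^sub>+\<^sub>1 + \<beta>\<^sub>k p\<^sub>k + \<gamma>\<^sub>k p\<^sub>k\<^sub>-\<^sub>1\<close>.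
\<close>

fun recmat :: "(nat \<Rightarrow> 'a::comm_ring_1) \<Rightarrow> (nat \<Rightarrow> 'a) \<Rightarrow> nat \<Rightarrow> nat \<Rightarrow> 'a" where
  "recmat \<beta> \<gamma> 0 k = (if k = 0 then 1 else 0)"
| "recmat \<beta> \<gamma> (Suc n) k =
     (if k = 0 then 0 else recmat \<beta> \<gamma> n (k - 1)) + \<beta> k * recmat \<beta> \<gamma> n k
       + \<gamma> (Suc k) * recmat \<beta> \<gamma> n (Suc k)"

lemma recmat_eq_0: "n < k \<Longrightarrow> recmat \<beta> \<gamma> n k = 0"
  by (induction n arbitrary: k) auto

lift_definition Rec :: "(nat \<Rightarrow> 'a::comm_ring_1) \<Rightarrow> (nat \<Rightarrow> 'a) \<Rightarrow> 'a ltri" is recmat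
  by (simp add: recmat_eq_0)

text \<open>The recurrence is moved from the row to the vector v by shifting summation indices; on
  the right stands v transformed as the basis is under multiplication by x.\<close>

lemma sum_recmat_Suc:
  "(\<Sum>j\<le>Suc n. recmat \<beta> \<gamma> (Suc n) j * v j) =
   (\<Sum>j\<le>n. recmat \<beta> \<gamma> n j * (v (Suc j) + \<beta> j * v j + (if j = 0 then 0 else \<gamma> j * v (j - 1))))"
proof -
  let ?R = "recmat \<beta> \<gamma> n"
  have "(\<Sum>j\<le>Suc n. recmat \<beta> \<gamma> (Suc n) j * v j) =
      (\<Sum>j\<le>Suc n. (if j = 0 then 0 else ?R (j - 1)) * v j) +
      (\<Sum>j\<le>Suc n. \<beta> j * ?R j * v j) + (\<Sum>j\<le>Suc n. \<gamma> (Suc j) * ?R (Suc j) * v j)"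
    by (simp only: recmat.simps distrib_right sum.distrib)
  also have "(\<Sum>j\<le>Suc n. (if j = 0 then 0 else ?R (j - 1)) * v j) = (\<Sum>j\<le>n. ?R j * v (Suc j))"
    by (subst sum.atMost_Suc_shift) simp
  also have "(\<Sum>j\<le>Suc n. \<beta> j * ?R j * v j) = (\<Sum>j\<le>n. ?R j * (\<beta> j * v j))"
    by (simp add: recmat_eq_0 mult_ac)
  also have "(\<Sum>j\<le>Suc n. \<gamma> (Suc j) * ?R (Suc j) * v j) = (\<Sum>j<n. \<gamma> (Suc j) * ?R (Suc j) * v j)"
    by (rule sum.mono_neutral_right) (auto simp: recmat_eq_0)
  also have "\<dots> = (\<Sum>j\<le>n. ?R j * (if j = 0 then 0 else \<gamma> j * v (j - 1)))"
    by (subst sum.atMost_shift) (simp add: mult_ac)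
  finally show ?thesis
    by (simp add: sum.distrib algebra_simps)
qed

text \<open>Row j of F plays the role of the coordinates of p_j in a second family p'_k. The second
  assumption equates the two ways of computing x p_j, so substituting the p_j in the expansion of
  x^n yields its expansion in the p'_k.\<close>

lemma Rec_intertwine:
  assumes "entry F 0 0 = 1"
    and "\<And>j k. entry F (Suc j) k + \<beta> j * entry F j k + (if j = 0 then 0 else \<gamma> j * entry F (j - 1) k) =
       (if k = 0 then 0 else entry F j (k - 1)) + \<beta>' k * entry F j k + \<gamma>' (Suc k) * entry F j (Suc k)"
  shows "Rec \<beta> \<gamma> * F = Rec \<beta>' \<gamma>'"
proof (rule ltri_eqI)
  have "(\<Sum>j\<le>n. recmat \<beta> \<gamma> n j * entry F j k) = recmat \<beta>' \<gamma>' n k" for n k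
  proof (induction n arbitrary: k)
    case 0
    show ?case using assms(1) by (simp add: entry_eq_0)
  next
    case (Suc n)
    show ?case
      unfolding sum_recmat_Suc assms(2) recmat.simps(2)[of \<beta>' \<gamma>' n k] Suc[symmetric]
      by (simp add: sum.distrib sum_distrib_left algebra_simps)
  qed
  then show "entry (Rec \<beta> \<gamma> * F) n k = entry (Rec \<beta>' \<gamma>') n k" for n k
    by (simp add: entry_mult Rec.rep_eq)
qed

lemma power_eq_sum_Rec:
  fixes x :: "'a::comm_ring_1"
  shows "x ^ n = (\<Sum>j\<le>n. entry (Rec \<beta> (\<lambda>_. 0)) n j * (\<Prod>i<j. x - \<beta> i))"
proof -
  have "(\<Sum>j\<le>n. recmat \<beta> (\<lambda>_. 0) n j * (\<Prod>i<j. x - \<beta> i)) = x ^ n"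
  proof (induction n)
    case (Suc n)
    have *: "(\<Prod>i<Suc j. x - \<beta> i) + \<beta> j * (\<Prod>i<j. x - \<beta> i) + (if j = 0 then 0 else 0 * (\<Prod>i<j - 1. x - \<beta> i)) =
        x * (\<Prod>i<j. x - \<beta> i)" for j
      by (simp add: algebra_simps)
    show ?case
      unfolding sum_recmat_Suc * power_Suc Suc[symmetric] by (simp add: sum_distrib_left mult_ac)
  qed simp
  then show ?thesis
    by (simp add: Rec.rep_eq)
qed

text \<open>With \<open>\<gamma>\<close> = 0 the entries are complete homogeneous symmetric
  polynomials h_(n-m)(x_0, ..., x_m). The defining recurrence splits off the last variable; here the
  first one is split off, as the lecture hall paths require.\<close>

lemma recmat_shift:
  "recmat x (\<lambda>_. 0) (Suc n) (Suc m) =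
     recmat (\<lambda>i. x (Suc i)) (\<lambda>_. 0) n m + x 0 * recmat x (\<lambda>_. 0) n (Suc m)"
proof (induction n arbitrary: m)
  case (Suc n)
  let ?R = "recmat x (\<lambda>_. 0)"
  have "?R (Suc (Suc n)) (Suc m) = ?R (Suc n) m + x (Suc m) * ?R (Suc n) (Suc m)"
    by (subst recmat.simps(2)) (simp del: recmat.simps(2))
  also have "\<dots> = ?R (Suc n) m + x (Suc m) * (recmat (\<lambda>i. x (Suc i)) (\<lambda>_. 0) n m + x 0 * ?R n (Suc m))"
    unfolding Suc.IH ..
  also have "\<dots> = recmat (\<lambda>i. x (Suc i)) (\<lambda>_. 0) (Suc n) m + x 0 * ?R (Suc n) (Suc m)"
  proof (cases m)
    case (Suc m')
    show ?thesis unfolding Suc Suc.IH[of m'] by (simp add: algebra_simps)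
  qed (simp add: algebra_simps)
  finally show ?case .
qed simp

subsection \<open>q-binomial matrices\<close>

lift_definition qbm :: "'a::comm_ring_1 \<Rightarrow> (nat \<Rightarrow> 'a) \<Rightarrow> 'a ltri" is
  "\<lambda>q f n k. qbin q n k * (\<Prod>i=k..<n. f i)"
  by (simp add: qbin_eq_0)

text \<open>For s = 0 this is \<open>qbm q f\<close>. In general \<open>Zmat_step\<close> peels off
  factors \<open>qbm\<close>, each time multiplying the weight by s q^(2i), and
  \<open>Zmat_mult_Amat\<close> shows it to be inverse to an \<open>Amat\<close>.\<close>

lift_definition Zmat :: "'a::field \<Rightarrow> 'a \<Rightarrow> (nat \<Rightarrow> 'a) \<Rightarrow> 'a ltri" is
  "\<lambda>q s f n k. qbin q n k * (\<Prod>i=k..<n. f i) / qpoch (s * q ^ (2 * k)) q (n - k)"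
  by (simp add: qbin_eq_0)

text \<open>
  With \<open>s = a b c d\<close> and a suitable \<open>f\<close> these are the coefficients of the Askey--Wilson polynomials in the
  basis \<open>\<phi>\<^sub>k\<close>. The argument \<open>s q\<^sup>n\<^sup>+\<^sup>k / q\<close> avoids a negative exponent at \<open>n = k = 0\<close>.
\<close>

lift_definition Amat :: "'a::field \<Rightarrow> 'a \<Rightarrow> (nat \<Rightarrow> 'a) \<Rightarrow> 'a ltri" is
  "\<lambda>q s f n k. qbin q n k * (\<Prod>i=k..<n. f i) / (q ^ (k * (n - k)) * qpoch (s * q ^ (n + k) / q) q (n - k))"
  by (simp add: qbin_eq_0)

lemma prod_nat_shift: "(\<Prod>i=k..<k + r. f i) = (\<Prod>i<r. f (k + i :: nat))"
  using prod.atLeastLessThan_shift_0[of f k "k + r"] by (simp add: atLeast0LessThan)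

lemma prod_split: "r \<le> m \<Longrightarrow> (\<Prod>i=k + r..<k + m. f i) * (\<Prod>i=k..<k + r. f i) = (\<Prod>i=k..<k + m::nat. f i :: 'a::comm_ring_1)"
  by (subst mult.commute, rule prod.atLeastLessThan_concat) auto

context q_generic
begin

text \<open>After \<open>qbin_trinomial\<close> the entry at (k + m, k) of the product is a constant
  times the q-binomial sum at z = x q^k, whose value is the product of the factors 1 - x q^i for k
  \<le> i < k + m.\<close>

lemma qbm_factor:
  "qbm q (\<lambda>i. g i * (1 - x * q ^ i)) = qbm q g * qbm q (\<lambda>i. - (x * q ^ i * g i))"
proof (rule ltri_eqI_shift)
  fix k m
  let ?c = "qbin q (k + m) k * (\<Prod>i=k..<k + m. g i)"
  have "entry (qbm q g * qbm q (\<lambda>i. - (x * q ^ i * g i))) (k + m) k =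
      (\<Sum>r\<le>m. ?c * (qbin q m r * (\<Prod>i<r. - (x * q ^ k * q ^ i))))"
    unfolding entry_mult_shift
  proof (intro sum.cong refl)
    fix r assume "r \<in> {..m}"
    then have r: "r \<le> m" by simp
    have "(\<Prod>i=k..<k + r. - (x * q ^ i * g i)) = (\<Prod>i=k..<k + r. g i) * (\<Prod>i=k..<k + r. - (x * q ^ i))"
      unfolding prod.distrib[symmetric] by (simp add: mult_ac)
    also have "(\<Prod>i=k..<k + r. - (x * q ^ i)) = (\<Prod>i<r. - (x * q ^ k * q ^ i))"
      unfolding prod_nat_shift by (simp add: power_add mult_ac)
    finally have "entry (qbm q g) (k + m) (k + r) * entry (qbm q (\<lambda>i. - (x * q ^ i * g i))) (k + r) k =
        (qbin q (k + m) (k + r) * qbin q (k + r) k) * ((\<Prod>i=k + r..<k + m. g i) * (\<Prod>i=k..<k + r. g i)) *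
        (\<Prod>i<r. - (x * q ^ k * q ^ i))"
      unfolding qbm.rep_eq by (simp only: mult_ac)
    also have "\<dots> = ?c * (qbin q m r * (\<Prod>i<r. - (x * q ^ k * q ^ i)))"
      unfolding qbin_trinomial[OF r] prod_split[OF r] by (simp only: mult_ac)
    finally show "entry (qbm q g) (k + m) (k + r) * entry (qbm q (\<lambda>i. - (x * q ^ i * g i))) (k + r) k =
        ?c * (qbin q m r * (\<Prod>i<r. - (x * q ^ k * q ^ i)))" .
  qed
  also have "\<dots> = ?c * qpoch (x * q ^ k) q m"
    unfolding sum_distrib_left[symmetric] q_binomial_theorem ..
  also have "\<dots> = entry (qbm q (\<lambda>i. g i * (1 - x * q ^ i))) (k + m) k"
    by (simp add: qbm.rep_eq qpoch_def prod.distrib prod_nat_shift power_add mult_ac)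
  finally show "entry (qbm q (\<lambda>i. g i * (1 - x * q ^ i))) (k + m) k =
    entry (qbm q g * qbm q (\<lambda>i. - (x * q ^ i * g i))) (k + m) k" ..
qed

text \<open>The same reduction as in \<open>qbm_factor\<close> leaves \<open>durfee_sum\<close> at z
  = s q^(2k), divided by (z;q)_m.\<close>

lemma Zmat_step:
  assumes "\<And>i. s * q ^ i \<noteq> 1"
  shows "Zmat q s f = qbm q f * Zmat q s (\<lambda>i. s * q ^ (2 * i) * f i)"
proof (rule ltri_eqI_shift)
  fix k m
  define z where "z = s * q ^ (2 * k)"
  have nz: "qpoch z q r \<noteq> 0" for r
    by (rule qpoch_nonzero) (use assms in \<open>simp add: z_def mult.assoc flip: power_add\<close>)
  let ?c = "qbin q (k + m) k * (\<Prod>i=k..<k + m. f i)"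
  have "entry (qbm q f * Zmat q s (\<lambda>i. s * q ^ (2 * i) * f i)) (k + m) k =
      (\<Sum>r\<le>m. ?c / qpoch z q m * (qbin q m r * (\<Prod>i<r. z * q ^ (2 * i)) * qpoch (z * q ^ r) q (m - r)))"
    unfolding entry_mult_shift
  proof (intro sum.cong refl)
    fix r assume "r \<in> {..m}"
    then have r: "r \<le> m" by simp
    have "(\<Prod>i=k..<k + r. s * q ^ (2 * i) * f i) = (\<Prod>i=k..<k + r. f i) * (\<Prod>i=k..<k + r. s * q ^ (2 * i))"
      unfolding prod.distrib[symmetric] by (simp add: mult_ac)
    also have "(\<Prod>i=k..<k + r. s * q ^ (2 * i)) = (\<Prod>i<r. z * q ^ (2 * i))"
      unfolding prod_nat_shift z_def by (simp add: power_add mult_ac distrib_left)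
    finally have "entry (qbm q f) (k + m) (k + r) * entry (Zmat q s (\<lambda>i. s * q ^ (2 * i) * f i)) (k + r) k =
        (qbin q (k + m) (k + r) * qbin q (k + r) k) * ((\<Prod>i=k + r..<k + m. f i) * (\<Prod>i=k..<k + r. f i)) *
        (\<Prod>i<r. z * q ^ (2 * i)) / qpoch z q r"
      by (simp add: qbm.rep_eq Zmat.rep_eq z_def mult_ac)
    also have "\<dots> = ?c * qbin q m r * (\<Prod>i<r. z * q ^ (2 * i)) / qpoch z q r"
      unfolding qbin_trinomial[OF r] prod_split[OF r] by (simp add: mult_ac)
    also have "qpoch z q m = qpoch z q r * qpoch (z * q ^ r) q (m - r)"
      using qpoch_add[of z q r "m - r"] r by simp
    then have "?c * qbin q m r * (\<Prod>i<r. z * q ^ (2 * i)) / qpoch z q r =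
        ?c / qpoch z q m * (qbin q m r * (\<Prod>i<r. z * q ^ (2 * i)) * qpoch (z * q ^ r) q (m - r))"
      using nz[of m] by (simp add: field_simps)
    finally show "entry (qbm q f) (k + m) (k + r) * entry (Zmat q s (\<lambda>i. s * q ^ (2 * i) * f i)) (k + r) k =
      ?c / qpoch z q m * (qbin q m r * (\<Prod>i<r. z * q ^ (2 * i)) * qpoch (z * q ^ r) q (m - r))" .
  qed
  also have "\<dots> = ?c / qpoch z q m"
    unfolding sum_distrib_left[symmetric] durfee_sum by simp
  also have "\<dots> = entry (Zmat q s f) (k + m) k"
    by (simp add: Zmat.rep_eq z_def)
  finally show "entry (Zmat q s f) (k + m) k =
    entry (qbm q f * Zmat q s (\<lambda>i. s * q ^ (2 * i) * f i)) (k + m) k" ..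
qed

text \<open>The weights -f(i)/q^i supply the signs and the powers of q that turn the off-diagonal
  entries into multiples of \<open>orthogonality_sum\<close>.\<close>

lemma Zmat_mult_Amat:
  assumes "\<And>i. s * q ^ i \<noteq> 1"
  shows "Zmat q s (\<lambda>i. - (f i / q ^ i)) * Amat q s f = 1"
proof (rule ltri_eqI_shift)
  fix k m
  \<comment> \<open>This y is s q^(2k-1). The orthogonality relation concerns only y q^(i+1) = s
    q^(2k+i), so the assumption on s covers k = 0 as well.\<close>
  define y where "y = s * q ^ (2 * k) / q"
  have y: "y * q ^ Suc i \<noteq> 1" for i
    using assms[of "2 * k + i"] by (simp add: y_def power_add mult_ac)
  let ?c = "qbin q (k + m) k * (\<Prod>i=k..<k + m. f i) / (\<Prod>i=k..<k + m. - (q ^ i))"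
  have "entry (Zmat q s (\<lambda>i. - (f i / q ^ i)) * Amat q s f) (k + m) k =
    (\<Sum>r\<le>m. ?c * (qbin q m r * (\<Prod>i<r. - (q ^ i)) /
             (qpoch (y * q ^ Suc (2 * r)) q (m - r) * qpoch (y * q ^ r) q r)))"
    unfolding entry_mult_shift
  proof (intro sum.cong refl)
    fix r assume "r \<in> {..m}"
    then have r: "r \<le> m" by simp
    have 1: "(\<Prod>i=k + r..<k + m. - (f i / q ^ i)) = (\<Prod>i=k + r..<k + m. f i) / (\<Prod>i=k + r..<k + m. - (q ^ i))"
      unfolding prod_dividef[symmetric] by simp
    have 2: "(\<Prod>i=k..<k + m. - (q ^ i)) = (\<Prod>i=k + r..<k + m. - (q ^ i)) * (\<Prod>i=k..<k + r. - (q ^ i))"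
      using prod_split[OF r] by metis
    have 3: "(\<Prod>i=k..<k + r. - (q ^ i)) = (\<Prod>i<r. - (q ^ i)) * q ^ (k * r)"
      by (induction r) (simp_all add: power_add algebra_simps)
    have 4: "s * q ^ (2 * (k + r)) = y * q ^ Suc (2 * r)" "s * q ^ (k + r + k) / q = y * q ^ r"
      by (simp_all add: y_def power_add mult_ac mult_2 mult_2_right)
    have 5: "(\<Prod>i=k + r..<k + m. - (q ^ i)) \<noteq> 0" "(\<Prod>i<r. - (q ^ i)) \<noteq> 0"
      by auto
    have "entry (Zmat q s (\<lambda>i. - (f i / q ^ i))) (k + m) (k + r) =
      qbin q (k + m) (k + r) * (\<Prod>i=k + r..<k + m. f i) /
        (\<Prod>i=k + r..<k + m. - (q ^ i)) / qpoch (y * q ^ Suc (2 * r)) q (m - r)"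
      unfolding Zmat.rep_eq 1 4 by simp
    moreover have "entry (Amat q s f) (k + r) k =
      qbin q (k + r) k * (\<Prod>i=k..<k + r. f i) / q ^ (k * r) / qpoch (y * q ^ r) q r"
      unfolding Amat.rep_eq 4 by simp
    ultimately have "entry (Zmat q s (\<lambda>i. - (f i / q ^ i))) (k + m) (k + r) * entry (Amat q s f) (k + r) k =
      (qbin q (k + m) (k + r) * qbin q (k + r) k) * ((\<Prod>i=k + r..<k + m. f i) * (\<Prod>i=k..<k + r. f i)) /
      (\<Prod>i=k + r..<k + m. - (q ^ i)) / q ^ (k * r) / (qpoch (y * q ^ Suc (2 * r)) q (m - r) * qpoch (y * q ^ r) q r)"
      by (simp only: field_class.field_divide_inverse inverse_mult_distrib mult_ac)
    also have "\<dots> = qbin q (k + m) k * qbin q m r * (\<Prod>i=k..<k + m. f i) /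
      (\<Prod>i=k + r..<k + m. - (q ^ i)) / q ^ (k * r) / (qpoch (y * q ^ Suc (2 * r)) q (m - r) * qpoch (y * q ^ r) q r)"
      unfolding qbin_trinomial[OF r] prod_split[OF r] ..
    also have "\<dots> = ?c * (qbin q m r * (\<Prod>i<r. - (q ^ i)) /
             (qpoch (y * q ^ Suc (2 * r)) q (m - r) * qpoch (y * q ^ r) q r))"
      unfolding 2 3 using 5 by simp
    finally show "entry (Zmat q s (\<lambda>i. - (f i / q ^ i))) (k + m) (k + r) * entry (Amat q s f) (k + r) k =
      ?c * (qbin q m r * (\<Prod>i<r. - (q ^ i)) /
             (qpoch (y * q ^ Suc (2 * r)) q (m - r) * qpoch (y * q ^ r) q r))" .
  qed
  also have "\<dots> = (if m = 0 then 1 else 0)"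
    unfolding sum_distrib_left[symmetric] using orthogonality_sum[OF y, of m] by auto
  finally show "entry (Zmat q s (\<lambda>i. - (f i / q ^ i)) * Amat q s f) (k + m) k = entry 1 (k + m) k"
    by (simp add: entry_one)
qed

end

section \<open>Continuous q-Hermite and big q-Hermite polynomials\<close>

context q_generic
begin

lemma qbin_Suc_left:
  "qbin q (Suc (k + m)) k * (1 - q ^ Suc m) = qbin q (k + m) k * (1 - q ^ Suc (k + m))"
  using qbin_Suc_Suc[of m "k + m"] qbin_symmetric[of k m] qbin_symmetric[of k "Suc m"]
  by (simp del: qbin.simps)

text \<open>The right-hand recurrence belongs to the monic continuous big q-Hermite polynomials,
  that is, to the Askey--Wilson parameters (a, 0, 0, 0). The \<open>qbm\<close> factor expands the
  products \<phi>_k in them.\<close>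

lemma Rec_mult_qbm_inverse:
  assumes [simp]: "a \<noteq> 0" "(2::'a) \<noteq> 0"
  shows "Rec (\<lambda>j. (a * q ^ j + inverse (a * q ^ j)) / 2) (\<lambda>_. 0) * qbm q (\<lambda>i. - (1 / (2 * a * q ^ i))) =
    Rec (\<lambda>k. a * q ^ k / 2) (\<lambda>k. (1 - q ^ k) / 4)"
proof (rule Rec_intertwine)
  let ?f = "\<lambda>i. - (1 / (2 * a * q ^ i))"
  let ?F = "entry (qbm q ?f)"
  show "?F 0 0 = 1"
    by (simp add: qbm.rep_eq)
  fix j k
  let ?g = "(if k = 0 then 0 else ?F j (k - 1))"
  have "?F (Suc j) k + (a * q ^ j + inverse (a * q ^ j)) / 2 * ?F j k =
      ?g + a * q ^ k / 2 * ?F j k + (1 - q ^ Suc k) / 4 * ?F j (Suc k)"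
  proof (cases "k \<le> j")
    case False
    then consider "k = Suc j" | "Suc j < k" by linarith
    then show ?thesis
      by cases (auto simp: entry_eq_0 qbm.rep_eq qbin_eq_0)
  next
    case True
    then obtain m where j: "j = k + m" using le_Suc_ex by blast
    \<comment> \<open>All neighbouring entries are rational multiples of B, the entry at (j, k), in
      u = q^k and v = q^m. This turns the intertwining condition into an identity of rational
      functions.\<close>
    define B where "B = qbin q (k + m) k * (\<Prod>i=k..<k + m. ?f i)"
    define u v where "u = q ^ k" and "v = q ^ m"
    have nz: "u \<noteq> 0" "v \<noteq> 0" "1 - q * v \<noteq> 0" "q \<noteq> 0"
      using one_minus_power_nonzero[of m] by (simp_all add: u_def v_def del: one_minus_power_nonzero)
    have four: "(4::'a) \<noteq> 0"
    proof -
      have "(4::'a) = 2 * 2" by simp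
      then show ?thesis by (metis assms(2) mult_eq_0_iff)
    qed
    have 1: "?F (Suc j) k = - B * (1 - q * u * v) / (2 * a * u * v * (1 - q * v))"
    proof -
      have "?F (Suc j) k * (1 - q * v) = (qbin q (Suc (k + m)) k * (1 - q ^ Suc m)) * (\<Prod>i=k..<k + m. ?f i) * ?f (k + m)"
        unfolding j qbm.rep_eq v_def by (simp add: mult_ac del: qbin.simps)
      also have "\<dots> = - B * (1 - q * u * v) / (2 * a * u * v)"
        unfolding qbin_Suc_left by (simp add: B_def u_def v_def power_add mult_ac)
      finally show ?thesis using nz by (simp add: field_simps)
    qed
    have 2: "?g = - B * q * (1 - u) / (2 * a * u * (1 - q * v))"
    proof (cases k)
      case (Suc k')
      have "qbin q (k + m) k * (1 - q ^ Suc k') = qbin q (k + m) k' * (1 - q ^ Suc m)"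
        using qbin_Suc_right[of k' "k + m"] Suc by (simp add: Suc_diff_le del: qbin.simps)
      then have "?g * (1 - q * v) = (qbin q (k + m) k * (1 - q ^ Suc k')) * ?f k' * (\<Prod>i=k..<k + m. ?f i)"
        unfolding j qbm.rep_eq v_def Suc
        by (simp add: prod.atLeast_Suc_lessThan mult_ac del: qbin.simps)
      also have "\<dots> = - B * q * (1 - u) / (2 * a * u)"
        by (simp add: B_def u_def Suc)
      finally show ?thesis using nz by (simp add: field_simps)
    qed (simp add: u_def)
    have 3: "(1 - q ^ Suc k) / 4 * ?F j (Suc k) = - (a * u / 2) * (1 - v) * B"
    proof (cases m)
      case (Suc m')
      have "(1 - q ^ Suc k) * ?F j (Suc k) = (qbin q (k + m) (Suc k) * (1 - q ^ Suc k)) * (\<Prod>i=Suc k..<k + m. ?f i)"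
        unfolding j qbm.rep_eq by (simp add: mult_ac del: qbin.simps)
      also have "\<dots> = qbin q (k + m) k * (1 - v) * (\<Prod>i=Suc k..<k + m. ?f i)"
        using qbin_Suc_right[of k "k + m"] by (simp add: v_def)
      also have "(\<Prod>i=Suc k..<k + m. ?f i) = - 2 * a * u * (\<Prod>i=k..<k + m. ?f i)"
        using prod.atLeast_Suc_lessThan[of k "k + m" ?f] Suc by (simp add: u_def del: prod.op_ivl_Suc)
      finally have "(1 - q ^ Suc k) * ?F j (Suc k) = - 2 * a * u * (1 - v) * B"
        by (simp add: B_def mult_ac)
      then have "(1 - q ^ Suc k) / 4 * ?F j (Suc k) = - 2 * a * u * (1 - v) * B / 4"
        by (simp only: times_divide_eq_left)
      then show ?thesis
        using four by (simp add: divide_simps)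
    qed (simp add: v_def j entry_eq_0)
    have 4: "?F j k = B" "q ^ j = u * v" "q ^ k = u"
      by (simp_all add: B_def j qbm.rep_eq u_def v_def power_add)
    \<comment> \<open>X is the contribution of column k - 1. Writing 1 - q u v = (1 - q v) + q v (1
      - u) splits the entry in row j + 1 into X and a term that cancels against the inverse of a
      q^j.\<close>
    define X where "X = - B * q * (1 - u) / (2 * a * u * (1 - q * v))"
    have 5: "- B * (1 - q * u * v) / (2 * a * u * v * (1 - q * v)) = X - B / (2 * a * u * v)"
    proof -
      define w where "w = 1 - q * v"
      have e: "1 - q * u * v = w + q * v * (1 - u)"
        by (simp add: w_def algebra_simps)
      have "w \<noteq> 0" using nz by (simp add: w_def)
      then show ?thesis
        unfolding X_def e w_def[symmetric] using nz(1,2)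
        by (simp add: divide_simps) (simp add: algebra_simps)
    qed
    have 6: "(a * (u * v) + inverse (a * (u * v))) / 2 * B = a * (u * v) / 2 * B + B / (2 * a * u * v)"
      by (simp add: inverse_eq_divide add_divide_distrib distrib_left mult_ac)
    show ?thesis
      unfolding 1 2 3 4 5 6 X_def[symmetric] by (simp add: algebra_simps) (simp add: diff_divide_distrib)
  qed
  then show "?F (Suc j) k + (a * q ^ j + inverse (a * q ^ j)) / 2 * ?F j k +
      (if j = 0 then 0 else 0 * ?F (j - 1) k) =
      ?g + a * q ^ k / 2 * ?F j k + (1 - q ^ Suc k) / 4 * ?F j (Suc k)"
    by simp
qed

text \<open>The left-hand recurrence is that of the monic continuous q-Hermite polynomials. Here the
  intertwining condition falls apart into the Pascal rule (fact 1) and the absorption rule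
  \<open>qbin_Suc_Suc\<close> (fact 2).\<close>

lemma Rec_mult_qbm_const:
  "Rec (\<lambda>_. 0) (\<lambda>k. (1 - q ^ k) / 4) * qbm q (\<lambda>_. a / 2) =
    Rec (\<lambda>k. a * q ^ k / 2) (\<lambda>k. (1 - q ^ k) / 4)"
proof (rule Rec_intertwine)
  let ?F = "entry (qbm q (\<lambda>_. a / 2))"
  have F: "?F n k = qbin q n k * (a / 2) ^ (n - k)" for n k
    by (simp add: qbm.rep_eq)
  show "?F 0 0 = 1"
    by (simp add: F)
  fix j k
  let ?g = "(if k = 0 then 0 else ?F j (k - 1))"
  have 1: "?F (Suc j) k = ?g + a * q ^ k / 2 * ?F j k"
  proof (cases "k \<le> j")
    case False
    then consider "k = Suc j" | "Suc j < k" by linarith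
    then show ?thesis
      by cases (auto simp: F qbin_eq_0)
  next
    case True
    show ?thesis
    proof (cases k)
      case (Suc k')
      then have "j - k' = Suc (j - k)" using True by simp
      then show ?thesis
        using Suc by (simp add: F algebra_simps)
    qed (simp add: F algebra_simps)
  qed
  have 2: "(if j = 0 then 0 else (1 - q ^ j) / 4 * ?F (j - 1) k) = (1 - q ^ Suc k) / 4 * ?F j (Suc k)"
  proof (cases j)
    case (Suc j')
    show ?thesis
    proof (cases "k \<le> j'")
      case True
      then show ?thesis
        using qbin_Suc_Suc[of k j'] by (simp add: F Suc mult_ac del: qbin.simps power_Suc)
    qed (simp add: F Suc qbin_eq_0 del: qbin.simps)
  qed (simp add: F)
  show "?F (Suc j) k + 0 * ?F j k + (if j = 0 then 0 else (1 - q ^ j) / 4 * ?F (j - 1) k) =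
      ?g + a * q ^ k / 2 * ?F j k + (1 - q ^ Suc k) / 4 * ?F j (Suc k)"
    unfolding 1 2 by simp
qed

text \<open>Needed for level 2 of the graph, whose weights contain q^(-j) and so lead to q-binomials
  in base 1/q.\<close>

lemma qbin_inverse_base: "k \<le> n \<Longrightarrow> qbin (inverse q) n k * q ^ (k * (n - k)) = qbin q n k"
proof (induction n arbitrary: k)
  case (Suc n)
  show ?case
  proof (cases k)
    case k: (Suc k')
    show ?thesis
    proof (cases "k' = n")
      case False
      then have "k \<le> n" using Suc.prems k by simp
      then obtain e where n: "n = Suc k' + e"
        using k le_Suc_ex by blast
      have "inverse q ^ Suc k' * q ^ (Suc k' * Suc e) = q ^ (Suc k' * e)"
        by (simp add: power_add power_inverse field_simps)
      moreover have "qbin (inverse q) (Suc n) k * q ^ (k * (Suc n - k)) =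
          qbin (inverse q) n k' * (q ^ (k' * Suc e) * q ^ Suc e) +
          qbin (inverse q) n (Suc k') * (inverse q ^ Suc k' * q ^ (Suc k' * Suc e))"
        by (simp add: k n power_add algebra_simps)
      ultimately have "qbin (inverse q) (Suc n) k * q ^ (k * (Suc n - k)) =
          (qbin (inverse q) n k' * q ^ (k' * (n - k'))) * q ^ (n - k') +
          qbin (inverse q) n k * q ^ (k * (n - k))"
        by (simp add: k n mult.assoc del: qbin.simps power_Suc mult_Suc_right mult_Suc)
      also have "\<dots> = qbin q (Suc n) k"
        using Suc.IH[of k'] Suc.IH[of k] \<open>k \<le> n\<close> k qbin_pascal'[of k' n]
        by (simp add: mult_ac del: qbin.simps)
      finally show ?thesis .
    qed (simp add: k)
  qed simp
qed auto

text \<open>The q-binomial sum occurs at z = 1, and (1;q)_m vanishes for m > 0.\<close>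

lemma qbm_const_mult_inverse_base:
  "qbm q (\<lambda>_. \<alpha>) * qbm (inverse q) (\<lambda>i. - (\<alpha> * q ^ i)) = 1"
proof (rule ltri_eqI_shift)
  fix k m
  have "entry (qbm q (\<lambda>_. \<alpha>) * qbm (inverse q) (\<lambda>i. - (\<alpha> * q ^ i))) (k + m) k =
    (\<Sum>r\<le>m. qbin q (k + m) k * \<alpha> ^ m * (qbin q m r * (\<Prod>i<r. - (1 * q ^ i))))"
    unfolding entry_mult_shift
  proof (intro sum.cong refl)
    fix r assume "r \<in> {..m}"
    then have r: "r \<le> m" by simp
    have "(\<Prod>i=k..<k + r. - (\<alpha> * q ^ i)) = \<alpha> ^ r * q ^ (k * r) * (\<Prod>i<r. - (1 * q ^ i))"
      by (induction r) (simp_all add: power_add algebra_simps)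
    then have "entry (qbm q (\<lambda>_. \<alpha>)) (k + m) (k + r) * entry (qbm (inverse q) (\<lambda>i. - (\<alpha> * q ^ i))) (k + r) k =
        qbin q (k + m) (k + r) * (qbin (inverse q) (k + r) k * q ^ (k * r)) *
        (\<alpha> ^ (m - r) * \<alpha> ^ r) * (\<Prod>i<r. - (1 * q ^ i))"
      by (simp add: qbm.rep_eq mult_ac)
    also have "qbin (inverse q) (k + r) k * q ^ (k * r) = qbin q (k + r) k"
      using qbin_inverse_base[of k "k + r"] by simp
    also have "\<alpha> ^ (m - r) * \<alpha> ^ r = \<alpha> ^ m"
      using r by (simp flip: power_add)
    finally show "entry (qbm q (\<lambda>_. \<alpha>)) (k + m) (k + r) *
        entry (qbm (inverse q) (\<lambda>i. - (\<alpha> * q ^ i))) (k + r) k =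
        qbin q (k + m) k * \<alpha> ^ m * (qbin q m r * (\<Prod>i<r. - (1 * q ^ i)))"
      using qbin_trinomial[OF r, of k] by (simp add: mult_ac)
  qed
  also have "\<dots> = qbin q (k + m) k * \<alpha> ^ m * qpoch 1 q m"
    unfolding sum_distrib_left[symmetric] q_binomial_theorem ..
  also have "\<dots> = entry 1 (k + m) k"
    by (cases m) (simp_all add: entry_one qpoch_Suc_left)
  finally show "entry (qbm q (\<lambda>_. \<alpha>) * qbm (inverse q) (\<lambda>i. - (\<alpha> * q ^ i))) (k + m) k = entry 1 (k + m) k" .
qed

end

subsection \<open>The factorization of the mixed moments\<close>

text \<open>At level 0 the weights depend on j only, which gives complete homogeneous symmetric
  polynomials, hence \<open>Rec\<close> with \<open>\<gamma>\<close> = 0. The other weights are f(i)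
  q^j, or f(i) q^(-j) at level 2; from level 3 on f is read off at j = 0.\<close>

definition level_matrix :: "'a::field \<Rightarrow> 'a \<Rightarrow> 'a \<Rightarrow> 'a \<Rightarrow> 'a \<Rightarrow> nat \<Rightarrow> 'a ltri" where
  "level_matrix a b c d q t =
     (if t = 0 then Rec (\<lambda>j. (q ^ j + inverse (q ^ j)) / 2) (\<lambda>_. 0)
      else if t = 1 then qbm q (\<lambda>i. - (1 / (2 * q ^ i)))
      else if t = 2 then qbm (inverse q) (\<lambda>i. - (q ^ i / 2))
      else qbm q (\<lambda>i. w_AWH a b c d q (t - 3) i 0))"

primrec level_prod :: "'a::field \<Rightarrow> 'a \<Rightarrow> 'a \<Rightarrow> 'a \<Rightarrow> 'a \<Rightarrow> nat \<Rightarrow> 'a ltri" where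
  "level_prod a b c d q 0 = 1"
| "level_prod a b c d q (Suc t) = level_prod a b c d q t * level_matrix a b c d q t"

text \<open>The function f_m of the outline. Expanding the three binomials gives eight monomials,
  which for m > 0 are the weights of one period at j = 0; for m = 0 the first monomial differs from
  the weight a/2 in the graph.\<close>

definition block_weight :: "'a::field \<Rightarrow> 'a \<Rightarrow> 'a \<Rightarrow> 'a \<Rightarrow> 'a \<Rightarrow> nat \<Rightarrow> nat \<Rightarrow> 'a" where
  "block_weight a b c d q m i = - (1 / (2 * a * q ^ i)) * (a * b * c * d * q ^ (2 * i)) ^ m *
     (1 - a * b * q ^ i) * (1 - a * c * q ^ i) * (1 - a * d * q ^ i)"

definition AW_moments :: "'a::field \<Rightarrow> 'a \<Rightarrow> 'a \<Rightarrow> 'a \<Rightarrow> 'a \<Rightarrow> 'a ltri" where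
  "AW_moments a b c d q = Rec (\<lambda>j. (a * q ^ j + inverse (a * q ^ j)) / 2) (\<lambda>_. 0) *
     Zmat q (a * b * c * d) (block_weight a b c d q 0)"

lemma w_AWH_block:
  assumes "r < 8"
  shows "w_AWH a b c d q (8 * m + r) i j =
    1 / 2 * (a * b * c * d * q ^ (2 * i)) ^ m * q ^ j *
      (if r = 0 \<and> m = 0 then a
       else if r = 0 then - inverse a * q powi (- int i)
       else if r = 1 then b
       else if r = 2 then c
       else if r = 3 then - a * b * c * q ^ i
       else if r = 4 then d
       else if r = 5 then - a * b * d * q ^ i
       else if r = 6 then - a * c * d * q ^ i
       else a ^ 2 * b * c * d * q ^ (2 * i))"
proof -
  have "(8 * m + r) div 8 = m" using assms by simp
  then show ?thesis
    unfolding w_AWH_def Let_def by (simp only: add_eq_self_zero add_left_cancel)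
       simp
qed

lemma level_prod_add_8:
  "level_prod a b c d q (t + 8) = level_prod a b c d q t * level_matrix a b c d q t *
     level_matrix a b c d q (t + 1) * level_matrix a b c d q (t + 2) * level_matrix a b c d q (t + 3) *
     level_matrix a b c d q (t + 4) * level_matrix a b c d q (t + 5) * level_matrix a b c d q (t + 6) *
     level_matrix a b c d q (t + 7)"
  by (simp add: eval_nat_numeral)

locale AW_generic = q_generic q for q :: "'a::field" +
  fixes a b c d :: 'a
  assumes a_nonzero [simp]: "a \<noteq> 0" and two_nonzero [simp]: "(2::'a) \<noteq> 0"
    and abcd: "a * b * c * d * q ^ i \<noteq> 1"
begin

abbreviation "G \<equiv> level_matrix a b c d q"

lemma qbm_factor2:
  assumes "\<And>i. h1 i = - (x * q ^ i * h i)" "\<And>i. h2 i = - (y * q ^ i * h i)"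
    "\<And>i. h3 i = - (x * q ^ i * h2 i)"
  shows "qbm q (\<lambda>i. h i * (1 - x * q ^ i) * (1 - y * q ^ i)) = qbm q h * qbm q h1 * (qbm q h2 * qbm q h3)"
proof -
  have h: "(\<lambda>i. - (x * q ^ i * h i)) = h1" "(\<lambda>i. - (y * q ^ i * (h i * (1 - x * q ^ i)))) = (\<lambda>i. h2 i * (1 - x * q ^ i))"
    "(\<lambda>i. - (x * q ^ i * h2 i)) = h3"
    using assms by (auto simp: fun_eq_iff)
  show ?thesis
    unfolding qbm_factor h ..
qed

text \<open>Splitting off the factor with d first, then in each half those with c and b, produces
  the matrices in the order of the levels. The first matrix stays explicit because for m = 0 it is
  no level of the graph.\<close>

lemma qbm_block_weight:
  "qbm q (block_weight a b c d q m) =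
    qbm q (\<lambda>i. - (1 / (2 * a * q ^ i)) * (a * b * c * d * q ^ (2 * i)) ^ m) *
    (G (8 * m + 4) * G (8 * m + 5) * G (8 * m + 6) * G (8 * m + 7) * G (8 * m + 8) * G (8 * m + 9) * G (8 * m + 10))"
proof -
  define g where "g i = - (1 / (2 * a * q ^ i)) * (a * b * c * d * q ^ (2 * i)) ^ m" for i
  define w where "w r i = w_AWH a b c d q (8 * m + r) i 0" for r i
  have Gt: "G (8 * m + r + 3) = qbm q (w r)" for r
    by (simp add: level_matrix_def w_def[abs_def])
  have G: "G (8 * m + 4) = qbm q (w 1)" "G (8 * m + 5) = qbm q (w 2)" "G (8 * m + 6) = qbm q (w 3)"
    "G (8 * m + 7) = qbm q (w 4)" "G (8 * m + 8) = qbm q (w 5)" "G (8 * m + 9) = qbm q (w 6)"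
    "G (8 * m + 10) = qbm q (w 7)"
    using Gt[of 1] Gt[of 2] Gt[of 3] Gt[of 4] Gt[of 5] Gt[of 6] Gt[of 7] by (simp_all add: add.commute)
  have q2: "q ^ (2 * i) = q ^ i * q ^ i" for i
    by (simp add: mult_2 power_add)
  note w = w_AWH_block[of _ a b c d q m _ 0, folded w_def]
  have w1: "w 1 i = - (a * b * q ^ i * g i)" and w2: "w 2 i = - (a * c * q ^ i * g i)"
    and w3: "w 3 i = - (a * b * q ^ i * w 2 i)" and w4: "w 4 i = - (a * d * q ^ i * g i)"
    and w5: "w 5 i = - (a * b * q ^ i * w 4 i)" and w6: "w 6 i = - (a * c * q ^ i * w 4 i)"
    and w7: "w 7 i = - (a * b * q ^ i * w 6 i)" for i
    by (simp_all add: w g_def q2 power2_eq_square)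
  have "qbm q (block_weight a b c d q m) =
      qbm q (\<lambda>i. g i * (1 - a * b * q ^ i) * (1 - a * c * q ^ i) * (1 - a * d * q ^ i))"
    by (rule arg_cong[of _ _ "qbm q"]) (simp add: block_weight_def g_def fun_eq_iff)
  also have "\<dots> = qbm q (\<lambda>i. g i * (1 - a * b * q ^ i) * (1 - a * c * q ^ i)) *
      qbm q (\<lambda>i. w 4 i * (1 - a * b * q ^ i) * (1 - a * c * q ^ i))"
    unfolding qbm_factor[of "\<lambda>i. g i * (1 - a * b * q ^ i) * (1 - a * c * q ^ i)"] w4
    by (simp add: mult_ac)
  also have "\<dots> = qbm q g * (G (8 * m + 4) * G (8 * m + 5) * G (8 * m + 6) * G (8 * m + 7) *
      G (8 * m + 8) * G (8 * m + 9) * G (8 * m + 10))"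
    unfolding qbm_factor2[of "w 1" "a * b" g "w 2" "a * c" "w 3", OF w1 w2 w3]
      qbm_factor2[of "w 5" "a * b" "w 4" "w 6" "a * c" "w 7", OF w5 w6 w7] G
    by (simp only: mult.assoc)
  finally show ?thesis
    unfolding g_def[abs_def] .
qed

lemma Zmat_block_weight:
  "Zmat q (a * b * c * d) (block_weight a b c d q m) =
    qbm q (block_weight a b c d q m) * Zmat q (a * b * c * d) (block_weight a b c d q (Suc m))"
  unfolding Zmat_step[OF abcd, of "block_weight a b c d q m"]
  by (rule arg_cong[of _ _ "\<lambda>f. _ * Zmat q _ f"]) (simp add: block_weight_def fun_eq_iff)

text \<open>Levels 0 and 1 are the case a = 1 of \<open>Rec_mult_qbm_inverse\<close>, which gives
  the q-Hermite matrix times \<open>qbm q (\<lambda>_. 1 / 2)\<close>. Level 2 cancels this last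
  factor, and level 3 passes from q-Hermite to big q-Hermite polynomials with parameter a.\<close>

lemma level_prod_4:
  "level_prod a b c d q 4 =
    Rec (\<lambda>j. (a * q ^ j + inverse (a * q ^ j)) / 2) (\<lambda>_. 0) * qbm q (\<lambda>i. - (1 / (2 * a * q ^ i)))"
proof -
  let ?H = "Rec (\<lambda>_. 0) (\<lambda>k. (1 - q ^ k) / 4)"
  have "G 0 * G 1 = ?H * qbm q (\<lambda>_. 1 / 2)"
    using Rec_mult_qbm_inverse[of 1] Rec_mult_qbm_const[of 1] by (simp add: level_matrix_def)
  then have "G 0 * G 1 * G 2 = ?H * (qbm q (\<lambda>_. 1 / 2) * qbm (inverse q) (\<lambda>i. - (1 / 2 * q ^ i)))"
    by (simp add: level_matrix_def mult.assoc)
  also have "\<dots> = ?H"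
    unfolding qbm_const_mult_inverse_base by simp
  finally have "level_prod a b c d q 4 = ?H * G 3"
    by (simp add: eval_nat_numeral)
  also have "G 3 = qbm q (\<lambda>_. a / 2)"
    by (simp add: level_matrix_def w_AWH_def Let_def)
  finally show ?thesis
    unfolding Rec_mult_qbm_inverse[OF a_nonzero two_nonzero] Rec_mult_qbm_const .
qed

text \<open>The 8m + 11 levels consist of the three initial ones and m + 1 periods. Each induction
  step peels one \<open>block_weight\<close> matrix off \<open>Zmat\<close> and recognizes it as the
  next period.\<close>

lemma AW_moments_eq_level_prod:
  "AW_moments a b c d q =
    level_prod a b c d q (8 * m + 11) * Zmat q (a * b * c * d) (block_weight a b c d q (Suc m))"
proof (induction m)
  case 0
  have 4: "level_prod a b c d q 3 * G 3 = level_prod a b c d q 4"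
    by (simp add: eval_nat_numeral)
  have "level_prod a b c d q (8 * 0 + 11) = level_prod a b c d q (3 + 8)"
    by simp
  also have "\<dots> = level_prod a b c d q 4 * (G 4 * G 5 * G 6 * G 7 * G 8 * G 9 * G 10)"
    unfolding level_prod_add_8 4 mult.assoc by simp
  finally have "level_prod a b c d q (8 * 0 + 11) =
    level_prod a b c d q 4 * (G 4 * G 5 * G 6 * G 7 * G 8 * G 9 * G 10)" .
  moreover have "qbm q (block_weight a b c d q 0) =
      qbm q (\<lambda>i. - (1 / (2 * a * q ^ i))) * (G 4 * G 5 * G 6 * G 7 * G 8 * G 9 * G 10)"
    unfolding qbm_block_weight by simp
  moreover have "AW_moments a b c d q = Rec (\<lambda>j. (a * q ^ j + inverse (a * q ^ j)) / 2) (\<lambda>_. 0) *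
      qbm q (block_weight a b c d q 0) * Zmat q (a * b * c * d) (block_weight a b c d q (Suc 0))"
    unfolding AW_moments_def Zmat_block_weight[of 0] by (rule mult.assoc[symmetric])
  ultimately show ?case
    by (simp only: level_prod_4 mult.assoc)
next
  case (Suc m)
  \<comment> \<open>From the second period on the first monomial is a weight of the graph, so all
    eight factors are level matrices.\<close>
  have first: "G (8 * Suc m + 3) = qbm q (\<lambda>i. - (1 / (2 * a * q ^ i)) * (a * b * c * d * q ^ (2 * i)) ^ Suc m)"
  proof -
    have "w_AWH a b c d q (8 * Suc m) i 0 = - (1 / (2 * a * q ^ i)) * (a * b * c * d * q ^ (2 * i)) ^ Suc m" for i
      using w_AWH_block[of 0 a b c d q "Suc m" i 0] by (simp add: power_int_minus field_simps)
    then show ?thesis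
      unfolding level_matrix_def by simp
  qed
  have "level_prod a b c d q (8 * Suc m + 11) = level_prod a b c d q (8 * m + 11 + 8)"
    by (simp add: add.commute)
  also have "\<dots> = level_prod a b c d q (8 * m + 11) * qbm q (block_weight a b c d q (Suc m))"
    unfolding level_prod_add_8 qbm_block_weight first[symmetric] by (simp add: mult.assoc add.commute)
  finally show ?case
    unfolding Suc.IH Zmat_block_weight[of "Suc m"] by (simp add: mult.assoc)
qed

end

subsection \<open>Paths in the lecture hall graph\<close>

lemma fst_lh_vertex [simp]: "fst (lh_vertex t i j) = i"
  by (simp add: lh_vertex_def)

text \<open>Multiplied by i + 1 the height is t (i + 1) + j, and division with remainder recovers t
  and j.\<close>

lemma lh_vertex_inject:
  assumes "j \<le> i" "j' \<le> i'"
  shows "lh_vertex t i j = lh_vertex t' i' j' \<longleftrightarrow> t = t' \<and> i = i' \<and> j = j'"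
proof
  assume eq: "lh_vertex t i j = lh_vertex t' i' j'"
  then have [simp]: "i' = i" by (simp add: lh_vertex_def)
  have "real t + real j / real (i + 1) = real t' + real j' / real (i + 1)"
    using eq by (simp add: lh_vertex_def)
  then have "real (t * (i + 1) + j) = real (t' * (i + 1) + j')"
    by (simp add: field_simps)
  then have "t * (i + 1) + j = t' * (i + 1) + j'"
    by (simp only: of_nat_eq_iff)
  then have "(t * (i + 1) + j) div (i + 1) = (t' * (i + 1) + j') div (i + 1)"
    "(t * (i + 1) + j) mod (i + 1) = (t' * (i + 1) + j') mod (i + 1)"
    by simp_all
  then show "t = t' \<and> i = i' \<and> j = j'"
    using assms by (simp del: add_Suc_right)
qed simp

lemma lh_vertex_top: "lh_vertex t i (Suc i) = lh_vertex (Suc t) i 0"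
  by (simp add: lh_vertex_def divide_simps)

lemma south_step_iff:
  "j \<le> i \<Longrightarrow> south_step u (lh_vertex t i j) \<longleftrightarrow> u = lh_vertex t i (Suc j)"
  unfolding south_step_def by (auto simp: lh_vertex_inject)

text \<open>An east step into column i starts in column i - 1, where the index is at most i - 1; so
  no east step enters the vertex with j = i.\<close>

lemma east_step_iff:
  "j \<le> i \<Longrightarrow> east_step u (lh_vertex t i j) \<longleftrightarrow> j < i \<and> u = lh_vertex t (i - 1) j"
proof -
  assume j: "j \<le> i"
  have "east_step u (lh_vertex t i j) \<longleftrightarrow>
      (\<exists>t' i' j'. j' \<le> i' \<and> u = lh_vertex t' i' j' \<and> t = t' \<and> i = i' + 1 \<and> j = j')"
    unfolding east_step_def using j by (metis lh_vertex_inject le_SucI Suc_eq_plus1)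
  also have "\<dots> \<longleftrightarrow> j < i \<and> u = lh_vertex t (i - 1) j"
    by (cases i) auto
  finally show ?thesis .
qed

definition paths_from :: "nat \<Rightarrow> nat \<times> real \<Rightarrow> (nat \<Rightarrow> nat \<times> real) set" where
  "paths_from k v =
     {p. p 0 = v \<and>
         (\<forall>m. south_step (p (Suc m)) (p m) \<or> east_step (p (Suc m)) (p m)) \<and>
         (\<lambda>m. fst (p m)) \<longlonglongrightarrow> k \<and>
         filterlim (\<lambda>m. snd (p m)) at_top sequentially}"

lemma SE_paths_eq_paths_from: "SE_paths k n = paths_from k (lh_vertex 0 n 0)"
  by (simp add: SE_paths_def paths_from_def lh_vertex_def)

definition east_steps :: "(nat \<Rightarrow> nat \<times> real) \<Rightarrow> (nat \<times> nat \<times> nat) set" where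
  "east_steps p = {(t, i, j). j \<le> i \<and> (\<exists>m. p (Suc m) = lh_vertex t i j \<and> p m = lh_vertex t (i + 1) j)}"

lemma path_weight_eq: "path_weight w p = (\<Prod>(t, i, j)\<in>east_steps p. w t i j)"
  by (simp add: path_weight_def east_steps_def)

lemma case_nat_in_paths_from:
  "case_nat v p \<in> paths_from k v \<longleftrightarrow>
    (south_step (p 0) v \<or> east_step (p 0) v) \<and> p \<in> paths_from k (p 0)"
proof -
  let ?q = "case_nat v p"
  have "(\<forall>m. south_step (?q (Suc m)) (?q m) \<or> east_step (?q (Suc m)) (?q m)) \<longleftrightarrow>
      (south_step (p 0) v \<or> east_step (p 0) v) \<and>
      (\<forall>m. south_step (p (Suc m)) (p m) \<or> east_step (p (Suc m)) (p m))"
    by (auto split: nat.split)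
  moreover have "(\<lambda>m. fst (?q m)) \<longlonglongrightarrow> k \<longleftrightarrow> (\<lambda>m. fst (p m)) \<longlonglongrightarrow> k"
    by (subst filterlim_sequentially_Suc[symmetric]) simp
  moreover have "filterlim (\<lambda>m. snd (?q m)) at_top sequentially \<longleftrightarrow>
      filterlim (\<lambda>m. snd (p m)) at_top sequentially"
    by (subst filterlim_sequentially_Suc[symmetric]) simp
  ultimately show ?thesis
    by (auto simp: paths_from_def)
qed

text \<open>Case distinction on v_1. Since paths are read backwards from v_0, a south step leads up
  and an east step leads to the left.\<close>

lemma paths_from_unfold:
  assumes "j \<le> i"
  shows "paths_from k (lh_vertex t i j) =
    case_nat (lh_vertex t i j) ` paths_from k (lh_vertex t i (Suc j)) \<union>
    (if j < i then case_nat (lh_vertex t i j) ` paths_from k (lh_vertex t (i - 1) j) else {})"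
    (is "?L = ?R")
proof (intro equalityI subsetI)
  fix p assume p: "p \<in> ?L"
  define p' where "p' = (\<lambda>m. p (Suc m))"
  have pp': "p = case_nat (lh_vertex t i j) p'"
    using p by (auto simp: p'_def paths_from_def fun_eq_iff split: nat.split)
  have "p' \<in> paths_from k (p' 0)" "south_step (p' 0) (lh_vertex t i j) \<or> east_step (p' 0) (lh_vertex t i j)"
    using p unfolding pp' by (auto simp: case_nat_in_paths_from)
  then show "p \<in> ?R"
    unfolding pp' using assms by (auto simp: south_step_iff east_step_iff)
next
  fix p assume "p \<in> ?R"
  then obtain p' where "p = case_nat (lh_vertex t i j) p'"
    "p' \<in> paths_from k (lh_vertex t i (Suc j)) \<or> j < i \<and> p' \<in> paths_from k (lh_vertex t (i - 1) j)"
    by (auto split: if_splits)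
  moreover from this have "p' \<in> paths_from k (p' 0)"
    "p' 0 = lh_vertex t i (Suc j) \<or> j < i \<and> p' 0 = lh_vertex t (i - 1) j"
    by (auto simp: paths_from_def)
  ultimately show "p \<in> ?L"
    using assms by (simp add: case_nat_in_paths_from south_step_iff east_step_iff)
qed

lemma fst_path_le:
  assumes "p \<in> paths_from k v"
  shows "fst (p m) \<le> fst v"
proof (induction m)
  case (Suc m)
  have "south_step (p (Suc m)) (p m) \<or> east_step (p (Suc m)) (p m)"
    using assms by (auto simp: paths_from_def)
  then have "fst (p (Suc m)) \<le> fst (p m)"
    by (auto simp: south_step_def east_step_def)
  with Suc show ?case by simp
qed (use assms in \<open>simp add: paths_from_def\<close>)

lemma east_steps_column_less:
  "p \<in> paths_from k v \<Longrightarrow> (t, i, j) \<in> east_steps p \<Longrightarrow> i < fst v"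
  by (auto simp: east_steps_def) (metis Suc_le_eq fst_lh_vertex fst_path_le)

lemma east_steps_case_nat:
  "east_steps (case_nat v p) =
    east_steps p \<union> {(t, i, j). j \<le> i \<and> p 0 = lh_vertex t i j \<and> v = lh_vertex t (i + 1) j}"
  (is "?L = ?R")
proof -
  have "x \<in> ?L \<longleftrightarrow> x \<in> ?R" for x
  proof -
    obtain t i j where x: "x = (t, i, j)" by (metis prod_cases3)
    have "(\<exists>m. P m) \<longleftrightarrow> P 0 \<or> (\<exists>m. P (Suc m))" for P :: "nat \<Rightarrow> bool"
      by (metis not0_implies_Suc)
    from this[of "\<lambda>m. case_nat v p (Suc m) = lh_vertex t i j \<and> case_nat v p m = lh_vertex t (i + 1) j"]
    show ?thesis
      by (auto simp: east_steps_def x)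
  qed
  then show ?thesis by blast
qed

lemma east_steps_north:
  "p \<in> paths_from k (lh_vertex t i (Suc j)) \<Longrightarrow> east_steps (case_nat (lh_vertex t i j) p) = east_steps p"
  unfolding east_steps_case_nat by (auto simp: paths_from_def lh_vertex_def)

lemma east_steps_west:
  assumes "p \<in> paths_from k (lh_vertex t i j)" "j \<le> i"
  shows "east_steps (case_nat (lh_vertex t (Suc i) j) p) = insert (t, i, j) (east_steps p)"
    and "(t, i, j) \<notin> east_steps p"
proof -
  have "p 0 = lh_vertex t i j" using assms by (simp add: paths_from_def)
  then have "{(t', i', j'). j' \<le> i' \<and> p 0 = lh_vertex t' i' j' \<and> lh_vertex t (Suc i) j = lh_vertex t' (i' + 1) j'} = {(t, i, j)}"
    using assms(2) by (auto simp: lh_vertex_inject)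
  then show "east_steps (case_nat (lh_vertex t (Suc i) j) p) = insert (t, i, j) (east_steps p)"
    unfolding east_steps_case_nat by auto
  show "(t, i, j) \<notin> east_steps p"
    using east_steps_column_less[OF assms(1)] by fastforce
qed

text \<open>The columns are integers converging to k, hence eventually constant, while every east
  step changes the column.\<close>

lemma finite_east_steps:
  assumes "p \<in> paths_from k v"
  shows "finite (east_steps p)"
proof -
  have "(\<lambda>m. fst (p m)) \<longlonglongrightarrow> k" using assms by (simp add: paths_from_def)
  then have "\<forall>\<^sub>F m in sequentially. fst (p m) = k"
    by (simp add: tendsto_discrete)
  then obtain M where M: "\<And>m. m \<ge> M \<Longrightarrow> fst (p m) = k"
    by (auto simp: eventually_sequentially)
  have "east_steps p \<subseteq> (\<Union>m<M. {(t, i, j). j \<le> i \<and> p (Suc m) = lh_vertex t i j})"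
  proof (clarsimp simp: east_steps_def)
    fix t i j m assume "j \<le> i" "p (Suc m) = lh_vertex t i j" "p m = lh_vertex t (Suc i) j"
    moreover from this have "m < M"
      using M[of m] M[of "Suc m"] by (metis fst_lh_vertex le_SucI n_not_Suc_n not_le)
    ultimately show "\<exists>m\<in>{..<M}. p (Suc m) = lh_vertex t i j" by blast
  qed
  moreover have "finite {(t, i, j). j \<le> i \<and> u = lh_vertex t i j}" for u
  proof (cases "\<exists>x. x \<in> {(t, i, j). j \<le> i \<and> u = lh_vertex t i j}")
    case True
    then obtain x where x: "x \<in> {(t, i, j). j \<le> i \<and> u = lh_vertex t i j}" ..
    have "{(t, i, j). j \<le> i \<and> u = lh_vertex t i j} \<subseteq> {x}"
      using x by (auto simp: lh_vertex_inject)
    then show ?thesis by (rule finite_subset) simp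
  next
    case False
    then have "{(t, i, j). j \<le> i \<and> u = lh_vertex t i j} = {}" by blast
    then show ?thesis by (metis finite.emptyI)
  qed
  ultimately show ?thesis
    by (meson finite_UN_I finite_lessThan finite_subset)
qed

section \<open>Paths whose east steps all lie below height T\<close>

definition low_paths :: "nat \<Rightarrow> nat \<Rightarrow> nat \<times> real \<Rightarrow> (nat \<Rightarrow> nat \<times> real) set" where
  "low_paths T k v = {p \<in> paths_from k v. \<forall>(t, i, j)\<in>east_steps p. t < T}"

lemma low_paths_unfold:
  assumes "j \<le> i" "t < T"
  shows "low_paths T k (lh_vertex t i j) =
    case_nat (lh_vertex t i j) ` low_paths T k (lh_vertex t i (Suc j)) \<union>
    (if j < i then case_nat (lh_vertex t i j) ` low_paths T k (lh_vertex t (i - 1) j) else {})"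
proof -
  have w: "east_steps (case_nat (lh_vertex t i j) p) = insert (t, i - 1, j) (east_steps p)"
    if "j < i" "p \<in> paths_from k (lh_vertex t (i - 1) j)" for p
    using east_steps_west(1)[of p k t "i - 1" j] that by simp
  let ?v = "lh_vertex t i j" and ?low = "\<lambda>p. \<forall>(t, i, j)\<in>east_steps p. t < T"
  have "{p \<in> case_nat ?v ` paths_from k (lh_vertex t i (Suc j)). ?low p} =
      case_nat ?v ` low_paths T k (lh_vertex t i (Suc j))"
    by (auto simp: low_paths_def east_steps_north)
  moreover have "{p \<in> case_nat ?v ` paths_from k (lh_vertex t (i - 1) j). ?low p} =
      case_nat ?v ` low_paths T k (lh_vertex t (i - 1) j)" if "j < i"
    using w[OF that] assms(2) by (auto simp: low_paths_def)
  moreover have "{p \<in> A \<union> B. ?low p} = {p \<in> A. ?low p} \<union> {p \<in> B. ?low p}" for A B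
    by blast
  ultimately show ?thesis
    unfolding low_paths_def[of T k ?v] paths_from_unfold[OF assms(1)] by simp
qed

text \<open>East steps descend weakly as well, from t + j/(i+1) to t + j/(i+2).\<close>

lemma snd_path_mono:
  assumes "p \<in> paths_from k v"
  shows "snd v \<le> snd (p m)"
proof (induction m)
  case (Suc m)
  have "south_step (p (Suc m)) (p m) \<or> east_step (p (Suc m)) (p m)"
    using assms by (auto simp: paths_from_def)
  then have "snd (p m) \<le> snd (p (Suc m))"
    by (auto simp: south_step_def east_step_def lh_vertex_def divide_right_mono intro!: divide_left_mono)
  with Suc show ?case by simp
qed (use assms in \<open>simp add: paths_from_def\<close>)

text \<open>At height T no east step is left, so only the vertical line in column i remains, and it
  tends to (k, \<infinity>) only for i = k.\<close>

lemma low_paths_top: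
  "low_paths T k (lh_vertex T i 0) = (if i = k then {\<lambda>m. (i, real T + real m / real (i + 1))} else {})"
proof -
  let ?s = "\<lambda>m. (i, real T + real m / real (i + 1))"
  have s_vertex: "?s m = lh_vertex (T + m div (i + 1)) i (m mod (i + 1))" for m
  proof -
    have "real m = real (m div (i + 1)) * real (i + 1) + real (m mod (i + 1))"
      by (metis div_mult_mod_eq of_nat_add of_nat_mult)
    then show ?thesis
      by (simp add: lh_vertex_def field_simps)
  qed
  have only: "p = ?s" if "p \<in> low_paths T k (lh_vertex T i 0)" for p
  proof -
    have p: "p \<in> paths_from k (lh_vertex T i 0)" and low: "\<And>t i j. (t, i, j) \<in> east_steps p \<Longrightarrow> t < T"
      using that by (auto simp: low_paths_def)
    have "p m = ?s m" for m
    proof (induction m)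
      case 0
      show ?case using p by (simp add: paths_from_def lh_vertex_def)
    next
      case (Suc m)
      \<comment> \<open>An east step on level t < T ends below height t + 1 \<le> T, but the path
        never goes below T.\<close>
      have "\<not> east_step (p (Suc m)) (p m)"
      proof
        assume "east_step (p (Suc m)) (p m)"
        then obtain t i' j where e: "j \<le> i'" "p (Suc m) = lh_vertex t i' j" "p m = lh_vertex t (i' + 1) j"
          by (auto simp: east_step_def)
        then have "t < T" using low[of t i' j] by (auto simp: east_steps_def)
        moreover have "real T \<le> real t + real j / real (i' + 2)"
          using snd_path_mono[OF p, of m] e by (simp add: lh_vertex_def)
        moreover have "real j / real (i' + 2) < 1"
          using e(1) by simp
        ultimately show False by linarith
      qed
      then have "south_step (p (Suc m)) (p m)"
        using p by (auto simp: paths_from_def)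
      then have "p (Suc m) = lh_vertex (T + m div (i + 1)) i (Suc (m mod (i + 1)))"
        unfolding Suc s_vertex by (simp add: south_step_iff less_Suc_eq_le[symmetric])
      also have "\<dots> = ?s (Suc m)"
        using s_vertex[of m] by (simp add: lh_vertex_def add_divide_distrib)
      finally show ?case .
    qed
    then show ?thesis by blast
  qed
  have "?s \<in> low_paths T i (lh_vertex T i 0)"
  proof -
    have "south_step (?s (Suc m)) (?s m)" for m
    proof -
      have "?s (Suc m) = lh_vertex (T + m div (i + 1)) i (Suc (m mod (i + 1)))"
        using s_vertex[of m] by (simp add: lh_vertex_def add_divide_distrib)
      then show ?thesis
        unfolding s_vertex[of m] by (simp add: south_step_iff less_Suc_eq_le[symmetric])
    qed
    moreover have "filterlim (\<lambda>m. real T + real m / real (i + 1)) at_top sequentially"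
    proof (rule filterlim_tendsto_add_at_top[OF tendsto_const])
      have "filterlim (\<lambda>m. 1 / real (i + 1) * real m) at_top sequentially"
        by (rule filterlim_tendsto_pos_mult_at_top[OF tendsto_const _ filterlim_real_sequentially]) simp
      then show "filterlim (\<lambda>m. real m / real (i + 1)) at_top sequentially" by simp
    qed
    moreover have "east_steps ?s = {}"
      by (auto simp: east_steps_def lh_vertex_def)
    ultimately show ?thesis
      by (simp add: low_paths_def paths_from_def) (simp add: lh_vertex_def)
  qed
  moreover have "i = k" if "?s \<in> low_paths T k (lh_vertex T i 0)"
  proof -
    have "(\<lambda>m::nat. i) \<longlonglongrightarrow> k" using that by (simp add: low_paths_def paths_from_def)
    then show ?thesis by (simp add: LIMSEQ_const_iff)
  qed
  ultimately show ?thesis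
    using only by auto
qed

text \<open>
  The total weight of the continuations of a path from the vertex with index \<open>j = n + 1 - c\<close> in column \<open>n\<close>
  of a level, where \<open>u i\<close> accounts for the part above that level if the level is left in column \<open>i\<close>.
\<close>

fun level_sum :: "(nat \<Rightarrow> nat \<Rightarrow> 'r::comm_semiring_1) \<Rightarrow> (nat \<Rightarrow> 'r) \<Rightarrow> nat \<Rightarrow> nat \<Rightarrow> 'r" where
  "level_sum w u n 0 = u n"
| "level_sum w u n (Suc c) =
     level_sum w u n c + (if 0 < c then w (n - 1) (n - c) * level_sum w u (n - 1) c else 0)"

context
  fixes w :: "nat \<Rightarrow> nat \<Rightarrow> nat \<Rightarrow> 'r::comm_semiring_1" and T k :: nat
begin

definition low_sum :: "nat \<Rightarrow> nat \<Rightarrow> nat \<Rightarrow> 'r" where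
  "low_sum t i j = (\<Sum>p\<in>low_paths T k (lh_vertex t i j). path_weight w p)"

lemma low_sum_top: "low_sum T i 0 = (if i = k then 1 else 0)"
proof -
  have "path_weight w (\<lambda>m. (i, real T + real m / real (i + 1))) = 1" (is "path_weight w ?s = 1")
  proof -
    have "east_steps ?s = {}" by (auto simp: east_steps_def lh_vertex_def)
    then show ?thesis unfolding path_weight_eq by simp
  qed
  then show ?thesis
    unfolding low_sum_def low_paths_top by auto
qed

lemma inj_case_nat: "inj_on (case_nat v) A"
  by (rule inj_onI) (metis fun_eq_iff old.nat.simps(5))

lemma low_sum_step:
  assumes "j \<le> i" "t < T" "finite (low_paths T k (lh_vertex t i (Suc j)))"
    "j < i \<Longrightarrow> finite (low_paths T k (lh_vertex t (i - 1) j))"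
  shows "low_sum t i j = low_sum t i (Suc j) + (if j < i then w t (i - 1) j * low_sum t (i - 1) j else 0)"
proof -
  let ?v = "lh_vertex t i j"
  let ?N = "case_nat ?v ` low_paths T k (lh_vertex t i (Suc j))"
  let ?W = "if j < i then case_nat ?v ` low_paths T k (lh_vertex t (i - 1) j) else {}"
  have "low_sum t i j = sum (path_weight w) ?N + sum (path_weight w) ?W"
    unfolding low_sum_def low_paths_unfold[OF assms(1,2)]
  proof (rule sum.union_disjoint)
    show "?N \<inter> ?W = {}"
    proof -
      have "case_nat ?v p \<noteq> case_nat ?v p'"
        if "p \<in> low_paths T k (lh_vertex t i (Suc j))" "p' \<in> low_paths T k (lh_vertex t (i - 1) j)" "j < i" for p p'
      proof
        assume "case_nat ?v p = case_nat ?v p'"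
        then have "p 0 = p' 0" by (metis old.nat.simps(5))
        then have "fst (lh_vertex t i (Suc j)) = fst (lh_vertex t (i - 1) j)"
          using that by (auto simp: low_paths_def paths_from_def)
        with that(3) show False by simp
      qed
      then show ?thesis by (auto split: if_splits)
    qed
  qed (use assms in auto)
  also have "sum (path_weight w) ?N = low_sum t i (Suc j)"
    unfolding low_sum_def
    by (subst sum.reindex[OF inj_case_nat])
       (auto intro!: sum.cong simp: path_weight_eq low_paths_def east_steps_north)
  also have "sum (path_weight w) ?W = (if j < i then w t (i - 1) j * low_sum t (i - 1) j else 0)"
  proof (cases "j < i")
    case True
    have "path_weight w (case_nat ?v p) = w t (i - 1) j * path_weight w p"
      if "p \<in> low_paths T k (lh_vertex t (i - 1) j)" for p
    proof -
      have p: "p \<in> paths_from k (lh_vertex t (i - 1) j)" using that by (simp add: low_paths_def)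
      show ?thesis
        using east_steps_west[OF p] finite_east_steps[OF p] True by (simp add: path_weight_eq)
    qed
    then show ?thesis
      using True by (simp add: sum.reindex[OF inj_case_nat] low_sum_def sum_distrib_left)
  qed simp
  finally show ?thesis .
qed

text \<open>Finiteness is carried through the induction because a sum over an infinite set would
  default to 0 and break \<open>low_sum_step\<close>.\<close>

lemma low_sum_level:
  assumes "t < T" "\<And>i. finite (low_paths T k (lh_vertex (Suc t) i 0))" "c \<le> Suc n"
  shows "finite (low_paths T k (lh_vertex t n (Suc n - c))) \<and>
    low_sum t n (Suc n - c) = level_sum (w t) (\<lambda>i. low_sum (Suc t) i 0) n c"
  using assms(3)
proof (induction c arbitrary: n)
  case 0
  show ?case using assms(2) by (simp add: lh_vertex_top low_sum_def)
next
  case (Suc c)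
  then have c: "c \<le> n" by simp
  have 1: "finite (low_paths T k (lh_vertex t n (Suc (n - c))))"
    "low_sum t n (Suc (n - c)) = level_sum (w t) (\<lambda>i. low_sum (Suc t) i 0) n c"
    using Suc.IH[of n] c by (simp_all add: Suc_diff_le)
  have 2: "finite (low_paths T k (lh_vertex t (n - 1) (n - c)))"
    "low_sum t (n - 1) (n - c) = level_sum (w t) (\<lambda>i. low_sum (Suc t) i 0) (n - 1) c" if "0 < c"
    using Suc.IH[of "n - 1"] c that by simp_all
  have lt: "n - c < n \<longleftrightarrow> 0 < c" using c by auto
  have "finite (low_paths T k (lh_vertex t n (n - c)))"
    using 1 2 lt by (subst low_paths_unfold) (auto simp: assms(1))
  moreover have "low_sum t n (n - c) = level_sum (w t) (\<lambda>i. low_sum (Suc t) i 0) n (Suc c)"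
    using 1 2 lt by (subst low_sum_step) (auto simp: assms(1))
  ultimately show ?case by simp
qed

lemma finite_low_paths: "t \<le> T \<Longrightarrow> finite (low_paths T k (lh_vertex t n 0))"
proof (induction "T - t" arbitrary: t n)
  case 0
  then show ?case by (simp add: low_paths_top)
next
  case (Suc d)
  then have "finite (low_paths T k (lh_vertex (Suc t) i 0))" for i by simp
  from low_sum_level[OF _ this, of "Suc n" n] Suc.hyps show ?case by simp
qed

lemma low_sum_Suc:
  "t < T \<Longrightarrow> low_sum t n 0 = level_sum (w t) (\<lambda>i. low_sum (Suc t) i 0) n (Suc n)"
  using low_sum_level[of t "Suc n" n] finite_low_paths[of "Suc t"] by simp

end

section \<open>Evaluation of a single level\<close>

text \<open>A path from column n and index n - c that leaves the level in column m takes its n - m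
  east steps at weakly increasing indices between n - c and m. These are partitions in a box with
  sides n - m and c - (n - m), counted by the q-binomial; the induction is the Pascal rule.\<close>

lemma level_sum_q:
  fixes u :: "nat \<Rightarrow> 'r::comm_ring_1"
  assumes w: "\<And>i j. j \<le> i \<Longrightarrow> w i j = f i * q ^ j" and "c \<le> n"
  shows "level_sum w u n (Suc c) =
    (\<Sum>m\<le>n. (\<Prod>i=m..<n. f i) * q ^ ((n - c) * (n - m)) * qbin q c (n - m) * u m)"
  using assms(2)
proof (induction c arbitrary: n)
  case 0
  have "(\<Sum>m\<le>n. (\<Prod>i=m..<n. f i) * q ^ ((n - 0) * (n - m)) * qbin q 0 (n - m) * u m) =
      (\<Sum>m\<in>{n}. (\<Prod>i=m..<n. f i) * q ^ ((n - 0) * (n - m)) * qbin q 0 (n - m) * u m)"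
    by (rule sum.mono_neutral_right) (auto simp: qbin_eq_0)
  then show ?case by simp
next
  case (Suc c)
  then obtain n' where n: "n = Suc n'" by (cases n) auto
  then have c: "c \<le> n'" using Suc.prems by simp
  let ?F = "\<lambda>m. (\<Prod>i=m..<n'. f i) * f n' * u m"
  have "level_sum w u n (Suc (Suc c)) =
      f n' * q ^ (n' - c) * level_sum w u n' (Suc c) + level_sum w u (Suc n') (Suc c)"
    unfolding n by (subst level_sum.simps(2)) (simp add: w add.commute del: level_sum.simps)
  also have "level_sum w u (Suc n') (Suc c) =
      (\<Sum>m\<le>n'. ?F m * q ^ (Suc (n' - c) * Suc (n' - m)) * qbin q c (Suc (n' - m))) + u n"
    using c by (subst Suc.IH) (auto simp: n Suc_diff_le mult_ac intro!: sum.cong simp del: mult_Suc mult_Suc_right)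
  also have "f n' * q ^ (n' - c) * level_sum w u n' (Suc c) =
      (\<Sum>m\<le>n'. ?F m * (q ^ ((n' - c) * Suc (n' - m)) * qbin q c (n' - m)))"
    unfolding Suc.IH[OF c] sum_distrib_left by (simp add: power_add mult_ac)
  also have "(\<Sum>m\<le>n'. ?F m * (q ^ ((n' - c) * Suc (n' - m)) * qbin q c (n' - m))) +
      ((\<Sum>m\<le>n'. ?F m * q ^ (Suc (n' - c) * Suc (n' - m)) * qbin q c (Suc (n' - m))) + u n) =
      (\<Sum>m\<le>n'. ?F m * (q ^ ((n' - c) * Suc (n' - m)) * qbin q (Suc c) (Suc (n' - m)))) + u n"
  proof -
    have "F * (q ^ (A * Suc B) * Y) + F * q ^ (Suc A * Suc B) * X =
        F * (q ^ (A * Suc B) * (Y + q ^ Suc B * X))" for F X Y :: 'r and A B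
      by (simp add: power_add algebra_simps)
    then show ?thesis
      by (simp only: add.assoc[symmetric] sum.distrib[symmetric] qbin.simps(3))
  qed
  also have "\<dots> = (\<Sum>m\<le>n. (\<Prod>i=m..<n. f i) * q ^ ((n - Suc c) * (n - m)) * qbin q (Suc c) (n - m) * u m)"
    by (auto simp: n Suc_diff_le mult_ac intro!: sum.cong simp del: qbin.simps(3) mult_Suc mult_Suc_right)
  finally show ?case .
qed

text \<open>The same weakly increasing index sequences, now weighted by x alone, sum to complete
  homogeneous symmetric polynomials in x_e, ..., x_(e+r). The recursion splits off the smallest
  index, as \<open>recmat_shift\<close> does.\<close>

lemma level_sum_symmetric:
  fixes u :: "nat \<Rightarrow> 'r::comm_ring_1"
  assumes w: "\<And>i j. j \<le> i \<Longrightarrow> w i j = x j"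
  shows "level_sum w u (e + c) (Suc c) = (\<Sum>r\<le>c. recmat (\<lambda>i. x (e + i)) (\<lambda>_. 0) c r * u (e + r))"
proof (induction c arbitrary: e)
  case (Suc c)
  let ?R = "recmat (\<lambda>i. x (e + i)) (\<lambda>_. 0)"
  have "level_sum w u (e + Suc c) (Suc (Suc c)) =
      level_sum w u (Suc e + c) (Suc c) + x e * level_sum w u (e + c) (Suc c)"
    by (subst level_sum.simps(2)) (simp add: w del: level_sum.simps)
  also have "level_sum w u (Suc e + c) (Suc c) =
      (\<Sum>r\<le>c. recmat (\<lambda>i. x (e + Suc i)) (\<lambda>_. 0) c r * u (e + Suc r))"
    unfolding Suc.IH by simp
  also have "x e * level_sum w u (e + c) (Suc c) = (\<Sum>r\<le>Suc c. x e * ?R c r * u (e + r))"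
    unfolding Suc.IH by (simp add: recmat_eq_0 sum_distrib_left mult_ac)
  also have "\<dots> = x e * ?R c 0 * u e + (\<Sum>r\<le>c. x e * ?R c (Suc r) * u (e + Suc r))"
    by (subst sum.atMost_Suc_shift) simp
  also have "(\<Sum>r\<le>c. recmat (\<lambda>i. x (e + Suc i)) (\<lambda>_. 0) c r * u (e + Suc r)) +
      (x e * ?R c 0 * u e + (\<Sum>r\<le>c. x e * ?R c (Suc r) * u (e + Suc r))) =
      ?R (Suc c) 0 * u e + (\<Sum>r\<le>c. ?R (Suc c) (Suc r) * u (e + Suc r))"
    unfolding recmat_shift by (simp add: sum.distrib algebra_simps)
  also have "\<dots> = (\<Sum>r\<le>Suc c. ?R (Suc c) r * u (e + r))"
    by (subst sum.atMost_Suc_shift) simp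
  finally show ?case .
qed simp

lemma (in q_generic) q_generic_inverse: "q_generic (inverse q)"
  by standard (simp_all add: power_inverse not_root_of_unity)

lemma (in q_generic) level_sum_qbm:
  assumes "\<And>i j. j \<le> i \<Longrightarrow> w i j = f i * q ^ j"
  shows "level_sum w u n (Suc n) = (\<Sum>m\<le>n. entry (qbm q f) n m * u m)"
proof -
  have "qbin q n (n - m) = qbin q n m" if "m \<le> n" for m
    using qbin_symmetric[of m "n - m"] that by simp
  moreover have "level_sum w u n (Suc n) =
      (\<Sum>m\<le>n. (\<Prod>i=m..<n. f i) * q ^ ((n - n) * (n - m)) * qbin q n (n - m) * u m)"
    by (rule level_sum_q) (use assms in auto)
  ultimately show ?thesis
    by (simp add: qbm.rep_eq mult_ac del: level_sum.simps)
qed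

context AW_generic
begin

lemma level_sum_level_matrix:
  "level_sum (w_AW a b c d q t) u n (Suc n) = (\<Sum>m\<le>n. entry (G t) n m * u m)"
proof -
  consider "t = 0" | "t = 1" | "t = 2" | "t > 2" by linarith
  then show ?thesis
  proof cases
    case 1
    have "w_AW a b c d q t i j = (q ^ j + inverse (q ^ j)) / 2" for i j
      using 1 by (simp add: w_AW_def power_int_minus)
    from level_sum_symmetric[of "w_AW a b c d q t" "\<lambda>j. (q ^ j + inverse (q ^ j)) / 2" u 0 n, OF this]
    show ?thesis
      using 1 by (simp add: level_matrix_def Rec.rep_eq)
  next
    case 2
    have "w_AW a b c d q t i j = - (1 / (2 * q ^ i)) * q ^ j" for i j
      using 2 by (simp add: w_AW_def power_int_diff)
    from level_sum_qbm[of "w_AW a b c d q t", OF this] show ?thesis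
      using 2 by (simp add: level_matrix_def)
  next
    case 3
    have "w_AW a b c d q t i j = - (q ^ i / 2) * inverse q ^ j" for i j
      using 3 by (simp add: w_AW_def power_int_diff power_inverse field_simps)
    from q_generic.level_sum_qbm[OF q_generic_inverse, of "w_AW a b c d q t", OF this] show ?thesis
      using 3 by (simp add: level_matrix_def)
  next
    case 4
    have "w_AW a b c d q t i j = w_AWH a b c d q (t - 3) i 0 * q ^ j" for i j
      using 4 by (simp add: w_AW_def w_AWH_def Let_def)
    from level_sum_qbm[of "w_AW a b c d q t", OF this] show ?thesis
      using 4 by (simp add: level_matrix_def)
  qed
qed

text \<open>Transfer matrix argument: the levels are peeled off from below, and at t = T the
  remaining sum is the indicator of column k.\<close>

lemma low_sum_eq_level_prod: "low_sum (w_AW a b c d q) T k 0 n 0 = entry (level_prod a b c d q T) n k"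
proof -
  let ?S = "low_sum (w_AW a b c d q) T k"
  have "?S 0 n 0 = (\<Sum>m\<le>n. entry (level_prod a b c d q t) n m * ?S t m 0)" if "t \<le> T" for t
    using that
  proof (induction t)
    case 0
    show ?case by (simp add: entry_one if_distrib[of "\<lambda>x. x * _"] cong: if_cong)
  next
    case (Suc t)
    have "?S t m 0 = (\<Sum>j\<le>n. entry (G t) m j * ?S (Suc t) j 0)" if "m \<le> n" for m
    proof -
      have "?S t m 0 = (\<Sum>j\<le>m. entry (G t) m j * ?S (Suc t) j 0)"
        using Suc.prems by (simp add: low_sum_Suc level_sum_level_matrix del: level_sum.simps)
      also have "\<dots> = (\<Sum>j\<le>n. entry (G t) m j * ?S (Suc t) j 0)"
        by (rule sum.mono_neutral_left) (use that in \<open>auto simp: entry_eq_0\<close>)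
      finally show ?thesis .
    qed
    then have "?S 0 n 0 = (\<Sum>m\<le>n. \<Sum>j\<le>n. entry (level_prod a b c d q t) n m * entry (G t) m j * ?S (Suc t) j 0)"
      using Suc by (simp add: sum_distrib_left mult.assoc)
    also have "\<dots> = (\<Sum>j\<le>n. entry (level_prod a b c d q (Suc t)) n j * ?S (Suc t) j 0)"
      by (subst sum.swap) (simp add: entry_mult sum_distrib_right)
    finally show ?case .
  qed
  from this[OF order_refl] show ?thesis
    by (simp add: low_sum_top if_distrib[of "\<lambda>x. _ * x"] entry_eq_0 cong: if_cong)
qed

end

subsection \<open>Expansion of the Askey--Wilson polynomials\<close>

text \<open>Each factor 1 - q^(i-n) times -q^(n-i) is 1 - q^(n-i). This turns the numerator
  (q^(-n);q)_k of the hypergeometric series into a q-binomial.\<close>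

lemma (in q_generic) qpoch_inverse_power:
  "k \<le> n \<Longrightarrow> qpoch (inverse (q ^ n)) q k * (\<Prod>i<k. - (q ^ (n - i))) = qbin q n k * qpoch q q k"
proof (induction k)
  case (Suc k)
  have f: "(1 - inverse (q ^ n) * q ^ k) * - (q ^ (n - k)) = 1 - q ^ (n - k)"
  proof -
    have "q ^ n = q ^ (n - k) * q ^ k" using Suc.prems by (simp flip: power_add)
    then show ?thesis by (simp add: field_simps)
  qed
  have "qpoch (inverse (q ^ n)) q (Suc k) * (\<Prod>i<Suc k. - (q ^ (n - i))) =
      qpoch (inverse (q ^ n)) q k * (\<Prod>i<k. - (q ^ (n - i))) * ((1 - inverse (q ^ n) * q ^ k) * - (q ^ (n - k)))"
    by (simp only: qpoch_Suc prod.lessThan_Suc mult_ac)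
  also have "\<dots> = qpoch (inverse (q ^ n)) q k * (\<Prod>i<k. - (q ^ (n - i))) * (1 - q ^ (n - k))"
    unfolding f ..
  also have "\<dots> = (qbin q n k * (1 - q ^ (n - k))) * qpoch q q k"
    using Suc by simp
  also have "\<dots> = qbin q n (Suc k) * qpoch q q (Suc k)"
    using qbin_Suc_right[of k n] Suc.prems by (simp add: qpoch_Suc mult_ac)
  finally show ?case .
qed simp

lemma prod_power_reflect:
  fixes q :: "'a::comm_ring_1"
  shows "(\<Prod>i<k. - (q ^ (k + m - i))) = q ^ (k * m) * (\<Prod>i<k. - (q ^ Suc i))"
proof -
  have "(\<Prod>i<k. - (q ^ (k + m - i))) = (\<Prod>i<k. q ^ m * - (q ^ Suc (k - Suc i)))"
    by (rule prod.cong) (auto simp flip: power_add power_Suc intro!: arg_cong[of _ _ "power q"])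
  also have "\<dots> = q ^ (m * k) * (\<Prod>i<k. - (q ^ Suc (k - Suc i)))"
    by (simp only: prod.distrib prod_constant card_lessThan power_mult)
  also have "(\<Prod>i<k. - (q ^ Suc (k - Suc i))) = (\<Prod>i<k. - (q ^ Suc i))"
    by (rule prod.nat_diff_reindex)
  finally show ?thesis by (simp add: mult.commute)
qed

definition AW_basis :: "'a::field \<Rightarrow> 'a \<Rightarrow> 'a \<Rightarrow> nat \<Rightarrow> 'a" where
  "AW_basis a q x k = (\<Prod>i<k. x - (a * q ^ i + inverse (a * q ^ i)) / 2)"

locale AW_generic_strict = AW_generic q a b c d for q a b c d :: "'a::field" +
  assumes ab: "a * b * q ^ i \<noteq> 1" and ac: "a * c * q ^ i \<noteq> 1" and ad: "a * d * q ^ i \<noteq> 1"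
begin

text \<open>The quotient of the prefactors (ab, ac, ad; q)_j / (2a)^j at j = i + 1 and j =
  i.\<close>

definition step_ratio where "step_ratio i = (1 - a * b * q ^ i) * (1 - a * c * q ^ i) * (1 - a * d * q ^ i) / (2 * a)"

text \<open>With x = (e + 1/e)/2, the factors for index i multiply to 1 - 2 a x q^i + a^2 q^(2i) =
  -2 a q^i (x - (a q^i + 1/(a q^i))/2).\<close>

lemma qpoch_mult_qpoch_basis:
  assumes [simp]: "e \<noteq> 0"
  shows "qpoch (a * e) q k * qpoch (a * inverse e) q k =
    (2 * a) ^ k * (\<Prod>i<k. - (q ^ i)) * AW_basis a q ((e + inverse e) / 2) k"
proof (induction k)
  case (Suc k)
  let ?x = "(e + inverse e) / 2" and ?y = "(a * q ^ k + inverse (a * q ^ k)) / 2"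
  have move: "2 * a * - Q * D = - (a * Q) * (2 * D)" for Q D
    by (simp add: mult_ac)
  have "2 * (?x - ?y) = (e + inverse e) - (a * q ^ k + inverse (a * q ^ k))"
    unfolding diff_divide_distrib[symmetric] by simp
  then have "2 * a * - (q ^ k) * (?x - ?y) = - (a * q ^ k) * ((e + inverse e) - (a * q ^ k + inverse (a * q ^ k)))"
    using move[of "q ^ k" "?x - ?y"] by (simp only:)
  also have "\<dots> = (1 - a * e * q ^ k) * (1 - a * inverse e * q ^ k)"
    by (simp add: field_simps)
  finally have *: "(1 - a * e * q ^ k) * (1 - a * inverse e * q ^ k) = 2 * a * - (q ^ k) * (?x - ?y)" ..
  have "qpoch (a * e) q (Suc k) * qpoch (a * inverse e) q (Suc k) =
      (qpoch (a * e) q k * qpoch (a * inverse e) q k) * ((1 - a * e * q ^ k) * (1 - a * inverse e * q ^ k))"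
    by (simp only: qpoch_Suc mult_ac)
  then show ?case
    unfolding Suc * AW_basis_def by (simp only: prod.lessThan_Suc power_Suc mult_ac)
qed (simp add: AW_basis_def)

lemma askey_wilson_expansion:
  assumes [simp]: "e \<noteq> 0"
  shows "askey_wilson n e a b c d q =
    (\<Sum>k\<le>n. entry (Amat q (a * b * c * d) step_ratio) n k * AW_basis a q ((e + inverse e) / 2) k)"
proof -
  define s where "s = a * b * c * d"
  define z where "z = s * q powi (int n - 1)"
  define P where "P j = qpoch (a * b) q j * qpoch (a * c) q j * qpoch (a * d) q j" for j
  let ?x = "(e + inverse e) / 2"
  define T where "T k = qpochs [q powi (- int n), z, a * e, a * inverse e] q k /
    qpochs (q # [a * b, a * c, a * d]) q k * q ^ k" for k
  have T_eq_0: "T k = 0" if "k > n" for k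
  proof -
    have "qpoch (q powi (- int n)) q k = 0"
      using that by (auto simp: qpoch_def power_int_minus intro!: bexI[of _ n])
    then show ?thesis by (simp add: T_def qpochs_def)
  qed
  have P_nz: "P j \<noteq> 0" for j
    using ab ac ad by (simp add: P_def qpoch_nonzero)
  have phi: "phi43 [q powi (- int n), z, a * e, a * inverse e] [a * b, a * c, a * d] q q = (\<Sum>k\<le>n. T k)"
  proof -
    have "Sum_any T = (\<Sum>k\<le>n. T k)"
      by (rule Sum_any.expand_superset) (use T_eq_0 in \<open>auto simp: not_le[symmetric]\<close>)
    then show ?thesis by (simp add: phi43_def T_def)
  qed
  have "askey_wilson n e a b c d q = P n / (2 ^ n * a ^ n * qpoch z q n) * (\<Sum>k\<le>n. T k)"
    unfolding askey_wilson_def z_def[unfolded s_def, symmetric] phi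
    by (simp add: qpochs_def P_def mult_ac)
  also have "\<dots> = (\<Sum>k\<le>n. P n / (2 ^ n * a ^ n * qpoch z q n) * T k)"
    by (rule sum_distrib_left)
  also have "\<dots> = (\<Sum>k\<le>n. entry (Amat q s step_ratio) n k * AW_basis a q ?x k)"
  proof (intro sum.cong refl)
    fix k assume "k \<in> {..n}"
    then obtain m where n: "n = k + m" using le_Suc_ex by auto
    \<comment> \<open>For n = 0 the parameter z is s/q, which may be 1, but then j = 0 and the
      product is empty.\<close>
    have z_nz: "qpoch z q j \<noteq> 0" if "j \<le> n" for j
    proof (rule qpoch_nonzero)
      fix i assume "i < j"
      with that obtain n' where "n = Suc n'" by (cases n) auto
      then show "z * q ^ i \<noteq> 1"
        using abcd[of "n' + i"] by (simp add: z_def s_def power_add mult_ac)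
    qed
    \<comment> \<open>The first k factors cancel against the numerator parameter z of the series;
      the others form the denominator of \<open>Amat\<close>.\<close>
    have z: "qpoch z q n = qpoch z q k * qpoch (s * q ^ (n + k) / q) q m"
    proof -
      have "z = s * q ^ n / q" by (simp add: z_def power_int_diff)
      then have "z * q ^ k = s * q ^ (n + k) / q" by (simp add: power_add)
      then show ?thesis unfolding n qpoch_add by simp
    qed
    have prods: "(\<Prod>i<k. - (q ^ i)) \<noteq> 0" "(\<Prod>i<k. - (q ^ (n - i))) \<noteq> 0" by auto
    have P: "P n = P k * (\<Prod>i=k..<n. step_ratio i) * (2 * a) ^ m"
    proof -
      have "(\<Prod>i=k..<n. step_ratio i) * (2 * a) ^ m = (\<Prod>i=k..<n. step_ratio i * (2 * a))"
        by (simp add: n prod.distrib)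
      also have "\<dots> = (\<Prod>i=k..<n. (1 - a * b * q ^ i) * (1 - a * c * q ^ i) * (1 - a * d * q ^ i))"
        by (simp add: step_ratio_def)
      finally have *: "(\<Prod>i=k..<n. step_ratio i) * (2 * a) ^ m = \<dots>" .
      have "P j = (\<Prod>i=0..<j. (1 - a * b * q ^ i) * (1 - a * c * q ^ i) * (1 - a * d * q ^ i))" for j
        by (simp add: P_def qpoch_def prod.distrib atLeast0LessThan)
      then show ?thesis
        unfolding mult.assoc * by (simp add: n prod.atLeastLessThan_concat)
    qed
    have qq: "qpoch (inverse (q ^ n)) q k = qbin q n k * qpoch q q k / (\<Prod>i<k. - (q ^ (n - i)))"
      using qpoch_inverse_power[of k n] prods by (simp add: n field_simps)
    have "(\<Prod>i<k. - (q ^ (n - i))) = q ^ (k * m) * (\<Prod>i<k. - (q ^ i)) * q ^ k"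
      unfolding n prod_power_reflect by (induction k) (simp_all add: mult_ac)
    then have qq: "qpoch (inverse (q ^ n)) q k =
        qbin q n k * qpoch q q k / (q ^ (k * m) * (\<Prod>i<k. - (q ^ i)) * q ^ k)"
      using qq by simp
    have T: "T k = qpoch (inverse (q ^ n)) q k * qpoch z q k *
        ((2 * a) ^ k * (\<Prod>i<k. - (q ^ i)) * AW_basis a q ?x k) / (qpoch q q k * P k) * q ^ k"
      using qpoch_mult_qpoch_basis[of e k]
      by (simp add: T_def qpochs_def P_def power_int_minus mult_ac)
    have A: "entry (Amat q s step_ratio) n k = qbin q n k * (\<Prod>i=k..<n. step_ratio i) / (q ^ (k * m) * qpoch (s * q ^ (n + k) / q) q m)"
      by (simp add: Amat.rep_eq n)
    have "2 ^ n * a ^ n = (2 * a) ^ m * (2 * a) ^ k"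
      by (simp add: n power_add power_mult_distrib mult_ac)
    then show "P n / (2 ^ n * a ^ n * qpoch z q n) * T k = entry (Amat q s step_ratio) n k * AW_basis a q ?x k"
      unfolding T A P z qq using P_nz[of k] z_nz[of k] z_nz[of n, unfolded z] prods(1)
      by (simp add: n) (simp add: mult_ac)
  qed
  finally show ?thesis by (simp add: s_def)
qed

text \<open>Inserting Z A = 1 into x^n = (C \<phi>)_n gives ((C Z)(A \<phi>))_n, where C Z is
  \<open>AW_moments\<close> and A \<phi> lists the Askey--Wilson polynomials.\<close>

lemma power_eq_sum_askey_wilson:
  assumes "e \<noteq> 0"
  shows "((e + inverse e) / 2) ^ n = (\<Sum>j\<le>n. entry (AW_moments a b c d q) n j * askey_wilson j e a b c d q)"
proof -
  let ?x = "(e + inverse e) / 2"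
  let ?B = "AW_basis a q ?x"
  let ?C = "Rec (\<lambda>j. (a * q ^ j + inverse (a * q ^ j)) / 2) (\<lambda>_. 0)"
  let ?A = "Amat q (a * b * c * d) step_ratio"
  have weight: "block_weight a b c d q 0 = (\<lambda>i. - (step_ratio i / q ^ i))"
    by (simp add: block_weight_def step_ratio_def fun_eq_iff)
  have "?C = ?C * (Zmat q (a * b * c * d) (block_weight a b c d q 0) * ?A)"
    unfolding weight Zmat_mult_Amat[OF abcd] by simp
  then have C: "?C = AW_moments a b c d q * ?A"
    by (simp add: AW_moments_def mult.assoc)
  have "?x ^ n = (\<Sum>k\<le>n. entry ?C n k * ?B k)"
    unfolding AW_basis_def by (rule power_eq_sum_Rec)
  also have "\<dots> = (\<Sum>k\<le>n. \<Sum>j\<le>n. entry (AW_moments a b c d q) n j * entry ?A j k * ?B k)"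
    by (subst C) (simp add: entry_mult sum_distrib_right)
  also have "\<dots> = (\<Sum>j\<le>n. \<Sum>k\<le>n. entry (AW_moments a b c d q) n j * entry ?A j k * ?B k)"
    by (rule sum.swap)
  also have "\<dots> = (\<Sum>j\<le>n. \<Sum>k\<le>j. entry (AW_moments a b c d q) n j * entry ?A j k * ?B k)"
    by (intro sum.cong refl sum.mono_neutral_right) (auto simp: entry_eq_0)
  also have "\<dots> = (\<Sum>j\<le>n. entry (AW_moments a b c d q) n j * askey_wilson j e a b c d q)"
    unfolding askey_wilson_expansion[OF assms] by (simp add: sum_distrib_left mult.assoc)
  finally show ?thesis .
qed

end

subsection \<open>Base change and uniqueness of the mixed moments\<close>

text \<open>The moments lie in \<open>aw_coef\<close>, the polynomials in its extension
  \<open>aw_fun\<close>. The generic results are applied in \<open>aw_fun\<close> and their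
  coefficients are identified along \<open>of_coef\<close>.\<close>

locale field_morphism =
  fixes h :: "'a::field \<Rightarrow> 'b::field"
  assumes add [simp]: "h (x + y) = h x + h y" and mult [simp]: "h (x * y) = h x * h y"
    and one [simp]: "h 1 = 1"
begin

lemma zero [simp]: "h 0 = 0"
  by (metis add add_0 add_cancel_left_left)

lemma uminus [simp]: "h (- x) = - h x"
  using add[of x "- x"] by (simp add: eq_neg_iff_add_eq_0 add.commute)

lemma diff [simp]: "h (x - y) = h x - h y"
  using add[of x "- y"] by simp

lemma nonzero: "x \<noteq> 0 \<Longrightarrow> h x \<noteq> 0"
  by (metis mult one right_inverse mult_zero_left zero_neq_one)

lemma eq_iff [simp]: "h x = h y \<longleftrightarrow> x = y"
  using nonzero[of "x - y"] by auto

lemma eq_1_iff [simp]: "h x = 1 \<longleftrightarrow> x = 1"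
  using eq_iff[of x 1] by simp

lemma eq_0_iff [simp]: "h x = 0 \<longleftrightarrow> x = 0"
  using eq_iff[of x 0] by simp

lemma inverse [simp]: "h (inverse x) = inverse (h x)"
proof (cases "x = 0")
  case False
  then have "h x * h (inverse x) = 1" by (simp flip: mult)
  then show ?thesis by (metis inverse_unique)
qed simp

lemma divide [simp]: "h (x / y) = h x / h y"
  by (simp add: divide_inverse)

lemma power [simp]: "h (x ^ n) = h x ^ n"
  by (induction n) auto

lemma two [simp]: "h 2 = 2"
  using add[of 1 1] unfolding one one_add_one .

lemma sum [simp]: "h (sum f A) = (\<Sum>x\<in>A. h (f x))"
  by (induction A rule: infinite_finite_induct) auto

lemma prod [simp]: "h (prod f A) = (\<Prod>x\<in>A. h (f x))"
  by (induction A rule: infinite_finite_induct) auto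

lemma qbin [simp]: "h (qbin q n k) = qbin (h q) n k"
  by (induction q n k rule: qbin.induct) auto

lemma qpoch [simp]: "h (qpoch z q n) = qpoch (h z) (h q) n"
  by (simp add: qpoch_def)

lemma recmat: "h (recmat \<beta> \<gamma> n k) = recmat (\<lambda>i. h (\<beta> i)) (\<lambda>i. h (\<gamma> i)) n k"
  by (induction n arbitrary: k) auto

lemma entry_Amat: "h (entry (Amat q s f) n k) = entry (Amat (h q) (h s) (\<lambda>i. h (f i))) n k"
  by (simp add: Amat.rep_eq)

lemma entry_AW_moments:
  "h (entry (AW_moments a b c d q) n k) = entry (AW_moments (h a) (h b) (h c) (h d) (h q)) n k"
  by (simp add: AW_moments_def entry_mult Rec.rep_eq recmat Zmat.rep_eq block_weight_def)

lemma q_generic: "q_generic q \<Longrightarrow> q_generic (h q)"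
  unfolding q_generic_def by (simp flip: power)

lemma AW_generic_strict:
  assumes "AW_generic_strict q a b c d"
  shows "AW_generic_strict (h q) (h a) (h b) (h c) (h d)"
proof -
  interpret AW_generic_strict q a b c d by fact
  have "q_generic (h q)" by (rule q_generic) unfold_locales
  moreover have "(2::'b) \<noteq> 0"
    using nonzero[OF two_nonzero] by simp
  ultimately show ?thesis
    unfolding AW_generic_strict_def AW_generic_def AW_generic_axioms_def AW_generic_strict_axioms_def
    using abcd ab ac ad by (simp flip: power mult)
qed

end

lemma of_coef_conv: "of_coef x = to_fract [:x:]"
  by (simp add: of_coef_def to_fract_def)

interpretation of_coef: field_morphism of_coef
  by standard (simp_all add: of_coef_conv mult.commute pCons_one flip: to_fract_mult to_fract_add)

lemma exp_theta_conv: "exp_theta = to_fract (monom 1 1)"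
  by (simp add: exp_theta_def to_fract_def monom_altdef)

lemma exp_theta_power: "exp_theta ^ m = to_fract (monom 1 m)"
  by (induction m) (simp_all add: exp_theta_conv mult_monom flip: to_fract_mult)

lemma exp_theta_nonzero: "exp_theta \<noteq> 0"
  by (simp add: exp_theta_conv)

section \<open>Linear independence of the Askey--Wilson polynomials\<close>

text \<open>Multiplication by e turns each factor x - c_i, a Laurent polynomial in e, into the
  quadratic polynomial e^2/2 - c_i e + 1/2. Questions about polynomials in x thus become questions
  about degrees in e.\<close>

lemma AW_basis_poly:
  assumes two: "(2::aw_coef) \<noteq> 0"
  obtains p where "exp_theta ^ k * AW_basis (of_coef a) (of_coef q) cos_theta k = to_fract p"
    "degree p = 2 * k" "lead_coeff p = 1 / 2 ^ k"
proof -
  define c where "c i = (a * q ^ i + inverse (a * q ^ i)) / 2" for i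
  define p where "p = (\<Prod>i<k. [:1/2, - c i, 1/2:])"
  have two': "(2::aw_fun) \<noteq> 0"
    using of_coef.nonzero[OF two] by simp
  have "exp_theta * (cos_theta - of_coef (c i)) = to_fract [:1/2, - c i, 1/2:]" for i
  proof -
    have "to_fract [:1/2, - c i, 1/2:] = of_coef (1/2) * (exp_theta * exp_theta + 1) - of_coef (c i) * exp_theta"
      unfolding of_coef_conv exp_theta_conv to_fract_1[symmetric]
      unfolding to_fract_mult[symmetric] to_fract_add[symmetric] to_fract_diff[symmetric]
      by (rule arg_cong[of _ _ to_fract]) (simp add: monom_altdef one_pCons)
    also have "\<dots> = exp_theta * (cos_theta - of_coef (c i))"
      using exp_theta_nonzero two' by (simp add: cos_theta_def field_simps)
    finally show ?thesis ..
  qed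
  then have "to_fract p = (\<Prod>i<k. exp_theta * (cos_theta - of_coef (c i)))"
    unfolding p_def by (induction k) (simp_all del: mult_pCons_left mult_pCons_right)
  then have "exp_theta ^ k * AW_basis (of_coef a) (of_coef q) cos_theta k = to_fract p"
    by (simp add: AW_basis_def c_def prod.distrib)
  moreover have "degree p = 2 * k \<and> lead_coeff p = 1 / 2 ^ k"
    unfolding p_def
  proof (induction k)
    case (Suc k)
    let ?P = "\<Prod>i<k. [:1/2, - c i, 1/2:]" and ?L = "[:1/2, - c k, 1/2:]"
    have L: "degree ?L = 2" using two by simp
    have "degree (?P * ?L) = 2 * Suc k"
      using two Suc L by (subst degree_mult_eq) auto
    moreover have "lead_coeff (?P * ?L) = 1 / 2 ^ k * (1 / 2)"
    proof -
      have "lead_coeff ?P = 1 / 2 ^ k" using Suc by blast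
      moreover have "lead_coeff ?L = 1 / 2"
        unfolding L by (simp add: numeral_2_eq_2)
      ultimately show ?thesis by (simp only: lead_coeff_mult)
    qed
    ultimately show ?case
      by (simp only: prod.lessThan_Suc) simp
  qed simp
  ultimately show ?thesis using that by blast
qed

text \<open>After multiplication by e^j the term with \<phi>_k has degree at most j + k, so the
  coefficient at 2j comes from k = j alone, where the \<open>Amat\<close> entry is 1.\<close>

lemma AW_poly:
  assumes "AW_generic_strict q a b c d"
  obtains p where "exp_theta ^ j * AW j a b c d q = to_fract p"
    "degree p \<le> 2 * j" "coeff p (2 * j) \<noteq> 0"
proof -
  interpret AW_generic_strict q a b c d by fact
  interpret h: AW_generic_strict "of_coef q" "of_coef a" "of_coef b" "of_coef c" "of_coef d"
    by (rule of_coef.AW_generic_strict) fact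
  have "\<exists>p. exp_theta ^ k * AW_basis (of_coef a) (of_coef q) cos_theta k = to_fract p \<and>
      degree p = 2 * k \<and> lead_coeff p = 1 / 2 ^ k" for k
    by (rule AW_basis_poly[OF two_nonzero, of k a q]) blast
  then obtain p where p: "\<And>k. exp_theta ^ k * AW_basis (of_coef a) (of_coef q) cos_theta k = to_fract (p k)"
    "\<And>k. degree (p k) = 2 * k" "\<And>k. lead_coeff (p k) = 1 / 2 ^ k"
    by metis
  define A where "A k = entry (Amat q (a * b * c * d) step_ratio) j k" for k
  have A: "entry (Amat (of_coef q) (of_coef a * of_coef b * of_coef c * of_coef d) h.step_ratio) j k = of_coef (A k)" for k
  proof -
    have "h.step_ratio = (\<lambda>i. of_coef (step_ratio i))" by (simp add: h.step_ratio_def step_ratio_def fun_eq_iff)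
    then show ?thesis by (simp add: A_def of_coef.entry_Amat)
  qed
  define g where "g = (\<Sum>k\<le>j. smult (A k) (monom 1 (j - k) * p k))"
  have "exp_theta ^ j * AW j a b c d q =
      (\<Sum>k\<le>j. exp_theta ^ j * (of_coef (A k) * AW_basis (of_coef a) (of_coef q) cos_theta k))"
    unfolding AW_def h.askey_wilson_expansion[OF exp_theta_nonzero] A
    by (simp add: cos_theta_def sum_distrib_left)
  also have "\<dots> = (\<Sum>k\<le>j. of_coef (A k) * (exp_theta ^ (j - k) * to_fract (p k)))"
  proof (intro sum.cong refl)
    fix k assume "k \<in> {..j}"
    then have "exp_theta ^ j = exp_theta ^ (j - k) * exp_theta ^ k"
      by (simp flip: power_add)
    then show "exp_theta ^ j * (of_coef (A k) * AW_basis (of_coef a) (of_coef q) cos_theta k) =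
      of_coef (A k) * (exp_theta ^ (j - k) * to_fract (p k))"
      unfolding p(1)[symmetric] by (simp add: mult_ac)
  qed
  also have "\<dots> = to_fract g"
    by (simp add: g_def of_coef_conv exp_theta_power flip: to_fract_mult)
  finally have "exp_theta ^ j * AW j a b c d q = to_fract g" .
  moreover have deg: "degree (smult (A k) (monom 1 (j - k) * p k)) \<le> j + k" if "k \<le> j" for k
  proof -
    have "degree (smult (A k) (monom 1 (j - k) * p k)) \<le> degree (monom 1 (j - k) :: aw_coef poly) + degree (p k)"
      by (rule order_trans[OF degree_smult_le degree_mult_le])
    also have "\<dots> \<le> (j - k) + 2 * k" by (simp add: p degree_monom_le)
    finally show ?thesis using that by simp
  qed
  then have "degree g \<le> 2 * j"
    unfolding g_def by (intro degree_sum_le order_trans[OF deg]) auto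
  moreover have "coeff g (2 * j) \<noteq> 0"
  proof -
    have "coeff g (2 * j) = (\<Sum>k\<in>{j}. coeff (smult (A k) (monom 1 (j - k) * p k)) (2 * j))"
      unfolding g_def coeff_sum
    proof (rule sum.mono_neutral_right)
      show "\<forall>k\<in>{..j} - {j}. coeff (smult (A k) (monom 1 (j - k) * p k)) (2 * j) = 0"
        by (intro ballI coeff_eq_0 le_less_trans[OF deg]) auto
    qed auto
    also have "\<dots> = A j * (1 / 2 ^ j)"
      using p(2,3)[of j] by (simp add: monom_0 one_pCons[symmetric])
    also have "A j = 1"
      by (simp add: A_def Amat.rep_eq)
    finally show ?thesis by simp
  qed
  ultimately show ?thesis using that by blast
qed

text \<open>In e^n times the relation, only j = n reaches degree 2n; hence s_n = 0 and the relation
  shortens.\<close>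

lemma AW_independent:
  assumes gen: "AW_generic_strict q a b c d"
    and "(\<Sum>j\<le>n. of_coef (s j) * AW j a b c d q) = 0" "j \<le> n"
  shows "s j = 0"
proof -
  have "\<exists>p. exp_theta ^ j * AW j a b c d q = to_fract p \<and> degree p \<le> 2 * j \<and> coeff p (2 * j) \<noteq> 0" for j
    by (rule AW_poly[OF gen, of j]) blast
  then obtain p where p: "\<And>j. exp_theta ^ j * AW j a b c d q = to_fract (p j)"
    "\<And>j. degree (p j) \<le> 2 * j" "\<And>j. coeff (p j) (2 * j) \<noteq> 0"
    by metis
  show ?thesis
    using assms(2,3)
  proof (induction n arbitrary: j)
    case 0
    then show ?case
      using p(1,3)[of 0] by auto
  next
    case (Suc n)
    let ?n = "Suc n"
    define g where "g = (\<Sum>j\<le>?n. smult (s j) (monom 1 (?n - j) * p j))"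
    have "0 = exp_theta ^ ?n * (\<Sum>j\<le>?n. of_coef (s j) * AW j a b c d q)"
      using Suc.prems by simp
    also have "\<dots> = (\<Sum>j\<le>?n. of_coef (s j) * (exp_theta ^ (?n - j) * to_fract (p j)))"
      unfolding sum_distrib_left
    proof (intro sum.cong refl)
      fix j assume "j \<in> {..?n}"
      then have "exp_theta ^ ?n = exp_theta ^ (?n - j) * exp_theta ^ j"
        by (simp flip: power_add power_Suc)
      then show "exp_theta ^ ?n * (of_coef (s j) * AW j a b c d q) =
          of_coef (s j) * (exp_theta ^ (?n - j) * to_fract (p j))"
        unfolding p(1)[symmetric] by (simp add: mult_ac)
    qed
    also have "\<dots> = to_fract g"
      by (simp add: g_def of_coef_conv exp_theta_power flip: to_fract_mult)
    finally have "g = 0" by simp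
    have "coeff g (2 * ?n) = (\<Sum>j\<in>{?n}. coeff (smult (s j) (monom 1 (?n - j) * p j)) (2 * ?n))"
      unfolding g_def coeff_sum
    proof (rule sum.mono_neutral_right)
      show "\<forall>j\<in>{..?n} - {?n}. coeff (smult (s j) (monom 1 (?n - j) * p j)) (2 * ?n) = 0"
      proof
        fix j assume j: "j \<in> {..?n} - {?n}"
        have "degree (smult (s j) (monom 1 (?n - j) * p j)) \<le> degree (monom 1 (?n - j) :: aw_coef poly) + degree (p j)"
          by (rule order_trans[OF degree_smult_le degree_mult_le])
        also have "\<dots> \<le> (?n - j) + 2 * j"
          by (intro add_mono p degree_monom_le)
        also have "\<dots> < 2 * ?n" using j by auto
        finally show "coeff (smult (s j) (monom 1 (?n - j) * p j)) (2 * ?n) = 0"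
          by (rule coeff_eq_0)
      qed
    qed auto
    then have "s ?n * coeff (p ?n) (2 * ?n) = 0"
      using \<open>g = 0\<close> by (simp add: monom_0 one_pCons[symmetric])
    then have "s ?n = 0" using p(3)[of ?n] by simp
    with Suc show ?case by (cases "j = ?n") auto
  qed
qed

text \<open>The rows of \<open>AW_moments\<close> satisfy the defining expansion and vanish beyond n
  by triangularity; \<open>AW_independent\<close> gives uniqueness, so the definite description
  picks them.\<close>

lemma sigma_AW_eq:
  assumes gen: "AW_generic_strict q a b c d"
  shows "sigma_AW n k a b c d q = entry (AW_moments a b c d q) n k"
proof -
  interpret h: AW_generic_strict "of_coef q" "of_coef a" "of_coef b" "of_coef c" "of_coef d"
    by (rule of_coef.AW_generic_strict) fact
  let ?s = "entry (AW_moments a b c d q) n"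
  have s: "cos_theta ^ n = (\<Sum>j\<le>n. of_coef (?s j) * AW j a b c d q)"
    unfolding of_coef.entry_AW_moments AW_def cos_theta_def
    by (rule h.power_eq_sum_askey_wilson) (rule exp_theta_nonzero)
  have "(THE s. (\<forall>j>n. s j = 0) \<and> cos_theta ^ n = (\<Sum>j\<le>n. of_coef (s j) * AW j a b c d q)) = ?s"
  proof (rule the_equality)
    fix s' assume s': "(\<forall>j>n. s' j = 0) \<and> cos_theta ^ n = (\<Sum>j\<le>n. of_coef (s' j) * AW j a b c d q)"
    then have "(\<Sum>j\<le>n. of_coef (s' j - ?s j) * AW j a b c d q) = 0"
      using s by (simp add: left_diff_distrib sum_subtractf)
    then have "s' j - ?s j = 0" if "j \<le> n" for j
      using AW_independent[OF gen, of "\<lambda>j. s' j - ?s j"] that by blast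
    moreover have "s' j = 0" "?s j = 0" if "\<not> j \<le> n" for j
      using that s' by (simp_all add: entry_eq_0)
    ultimately have "s' j = ?s j" for j
      by (cases "j \<le> n") auto
    then show "s' = ?s" by blast
  qed (use s in \<open>simp add: entry_eq_0\<close>)
  then show ?thesis by (simp add: sigma_AW_def)
qed

subsection \<open>Integrality and convergence in the variable d\<close>

lemma of_pow4_eq_to_fract: "of_pow4 = to_fract"
  by (simp add: of_pow4_def to_fract_def fun_eq_iff)

definition const4 :: "rat_q \<Rightarrow> pow4" where
  "const4 c = fps_const (fps_const (fps_const (fps_const c)))"

lemma const4_simps:
  "const4 (x * y) = const4 x * const4 y" "const4 (x + y) = const4 x + const4 y" "const4 1 = 1"
  by (simp_all add: const4_def)

lemma const4_power: "const4 (x ^ n) = const4 x ^ n"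
  by (induction n) (simp_all add: const4_simps)

lemma coeff4_const4: "coeff4 (const4 x) (0, 0, 0, 0) = x"
  by (simp add: coeff4_def const4_def)

lemma coeff4_0_mult: "coeff4 (f * g) (0, 0, 0, 0) = coeff4 f (0, 0, 0, 0) * coeff4 g (0, 0, 0, 0)"
  by (simp add: coeff4_def fps_mult_nth_0)

lemma coeff4_X_power_mult:
  "ed < N \<Longrightarrow> coeff4 (fps_X ^ N * f) (ea, eb, ec, ed) = 0"
  by (simp add: coeff4_def fps_X_power_mult_nth)

lemma coeff4_add: "coeff4 (f + g) e = coeff4 f e + coeff4 g e"
  by (simp add: coeff4_def split: prod.split)

lemma coeff4_sum: "coeff4 (sum f A) e = (\<Sum>x\<in>A. coeff4 (f x) e)"
  by (induction A rule: infinite_finite_induct)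
     (auto simp: coeff4_add, auto simp: coeff4_def split: prod.split)

lemma coeff4_eqI: "(\<And>e. coeff4 f e = coeff4 g e) \<Longrightarrow> f = g"
  by (intro fps_ext) (metis (mono_tags, lifting) coeff4_def case_prod_conv)

text \<open>The outermost \<open>fps_X\<close> is the variable d. The case N = 0 says that an
  element of the fraction field is a genuine power series.\<close>

definition d_divisible :: "nat \<Rightarrow> aw_coef \<Rightarrow> bool" where
  "d_divisible N x \<longleftrightarrow> (\<exists>f. x = of_pow4 (fps_X ^ N * f))"

abbreviation "integral4 \<equiv> d_divisible 0"

lemma integral4_iff: "integral4 x \<longleftrightarrow> (\<exists>f. x = of_pow4 f)"
  by (simp add: d_divisible_def)

lemma integral4_of_pow4 [intro]: "integral4 (of_pow4 f)"
  by (auto simp: integral4_iff)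

lemma d_divisible_mult [intro]:
  "d_divisible M x \<Longrightarrow> d_divisible N y \<Longrightarrow> d_divisible (M + N) (x * y)"
  unfolding d_divisible_def of_pow4_eq_to_fract
  by (metis (no_types, opaque_lifting) mult.assoc mult.left_commute power_add to_fract_mult)

lemma d_divisible_mult_left: "d_divisible N x \<Longrightarrow> integral4 y \<Longrightarrow> d_divisible N (x * y)"
  using d_divisible_mult[of N x 0 y] by simp

lemma d_divisible_mult_right: "integral4 x \<Longrightarrow> d_divisible N y \<Longrightarrow> d_divisible N (x * y)"
  using d_divisible_mult[of 0 x N y] by simp

lemma d_divisible_0 [simp, intro]: "d_divisible N 0"
  unfolding d_divisible_def of_pow4_eq_to_fract by (metis mult_zero_right to_fract_0)

lemma integral4_1 [simp, intro]: "integral4 1"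
  unfolding d_divisible_def of_pow4_eq_to_fract by (metis mult_1 power_0 to_fract_1)

lemma d_divisible_add [intro]: "d_divisible N x \<Longrightarrow> d_divisible N y \<Longrightarrow> d_divisible N (x + y)"
  unfolding d_divisible_def of_pow4_eq_to_fract by (metis distrib_left to_fract_add)

lemma d_divisible_uminus [intro]: "d_divisible N x \<Longrightarrow> d_divisible N (- x)"
  unfolding d_divisible_def of_pow4_eq_to_fract by (metis mult_minus_right to_fract_uminus)

lemma integral4_mult [intro]: "integral4 x \<Longrightarrow> integral4 y \<Longrightarrow> integral4 (x * y)"
  by (rule d_divisible_mult_left)

lemma integral4_diff [intro]: "integral4 x \<Longrightarrow> integral4 y \<Longrightarrow> integral4 (x - y)"
  using d_divisible_add[of 0 x "- y"] by auto

lemma integral4_power [intro]: "integral4 x \<Longrightarrow> integral4 (x ^ n)"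
  by (induction n) auto

lemma d_divisible_sum [intro]: "(\<And>x. x \<in> A \<Longrightarrow> d_divisible N (f x)) \<Longrightarrow> d_divisible N (sum f A)"
  by (induction A rule: infinite_finite_induct) auto

lemma integral4_prod [intro]: "(\<And>x. x \<in> A \<Longrightarrow> integral4 (f x)) \<Longrightarrow> integral4 (prod f A)"
  by (induction A rule: infinite_finite_induct) auto

lemma d_divisible_prod:
  assumes "finite A" "x \<in> A" "d_divisible N (f x)" "\<And>y. y \<in> A \<Longrightarrow> integral4 (f y)"
  shows "d_divisible N (prod f A)"
proof -
  have "prod f A = f x * prod f (A - {x})"
    using assms by (simp add: prod.remove)
  then show ?thesis
    using assms by (auto intro!: d_divisible_mult_left)
qed

lemma d_divisible_mono: "d_divisible N x \<Longrightarrow> M \<le> N \<Longrightarrow> d_divisible M x"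
proof -
  assume "d_divisible N x" "M \<le> N"
  then obtain f where "x = of_pow4 (fps_X ^ (M + (N - M)) * f)"
    by (auto simp: d_divisible_def)
  then show ?thesis
    unfolding d_divisible_def power_add by (metis mult.assoc)
qed

lemma integral4_qbin [intro]: "integral4 q \<Longrightarrow> integral4 (qbin q n k)"
  by (induction q n k rule: qbin.induct) auto

lemma integral4_inverse_const4: "x \<noteq> 0 \<Longrightarrow> integral4 (inverse (of_pow4 (const4 x)))"
proof -
  assume "x \<noteq> 0"
  then have "const4 x * const4 (inverse x) = 1"
    by (simp flip: const4_simps)
  then have "of_pow4 (const4 x) * of_pow4 (const4 (inverse x)) = 1"
    unfolding of_pow4_eq_to_fract by (simp flip: to_fract_mult)
  then have "inverse (of_pow4 (const4 x)) = of_pow4 (const4 (inverse x))"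
    by (rule inverse_unique)
  then show ?thesis by auto
qed

section \<open>Genericity, integrality and divisibility for the indeterminates\<close>

lemma var_conv:
  "var_a = of_pow4 (fps_const (fps_const (fps_const fps_X)))"
  "var_b = of_pow4 (fps_const (fps_const fps_X))"
  "var_c = of_pow4 (fps_const fps_X)"
  "var_d = of_pow4 fps_X"
  "var_q = of_pow4 (const4 (to_fract (monom 1 1)))"
  by (simp_all add: var_a_def var_b_def var_c_def var_d_def var_q_def const4_def to_fract_def monom_altdef)

lemma integral4_vars [simp, intro]:
  "integral4 var_a" "integral4 var_b" "integral4 var_c" "integral4 var_d" "integral4 var_q"
  by (auto simp: var_conv)

lemma integral4_inverse_q [simp, intro]: "integral4 (inverse var_q)"
  unfolding var_conv by (rule integral4_inverse_const4) simp

lemma rat_q_two: "(2::rat_q) \<noteq> 0"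
  unfolding one_add_one[symmetric] to_fract_1[symmetric] to_fract_add[symmetric] to_fract_eq_0_iff by simp

lemma integral4_inverse_2 [simp, intro]: "integral4 (inverse 2)"
proof -
  have "(2::aw_coef) = of_pow4 (const4 2)"
    unfolding of_pow4_eq_to_fract one_add_one[symmetric] const4_simps to_fract_add to_fract_1 ..
  then show ?thesis
    using integral4_inverse_const4[OF rat_q_two] by simp
qed

lemma aw_coef_two: "(2::aw_coef) \<noteq> 0"
proof
  assume "(2::aw_coef) = 0"
  moreover have "(2::aw_coef) = of_pow4 (const4 2)"
    unfolding of_pow4_eq_to_fract one_add_one[symmetric] const4_simps to_fract_add to_fract_1 ..
  ultimately have "const4 2 = 0"
    by (simp add: of_pow4_eq_to_fract)
  then show False
    using rat_q_two coeff4_const4[of 2] by (simp add: coeff4_def)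
qed

lemma var_nonzero: "var_a \<noteq> 0" "var_d \<noteq> 0" "var_q \<noteq> 0"
  by (simp_all add: var_conv of_pow4_eq_to_fract const4_def)

lemma integral4_div_q_power [intro]: "integral4 x \<Longrightarrow> integral4 (x / var_q ^ n)"
  by (simp add: divide_inverse power_inverse[symmetric]) auto

lemma integral4_q_powi [intro]: "integral4 (var_q powi z)"
  by (cases "z \<ge> 0") (auto simp: power_int_def)

lemma of_pow4_neq_1: "coeff4 f (0, 0, 0, 0) = 0 \<Longrightarrow> of_pow4 f \<noteq> 1"
  by (auto simp: of_pow4_eq_to_fract coeff4_def simp flip: to_fract_1)

lemma coeff4_vars:
  "coeff4 (fps_const (fps_const (fps_const fps_X))) (0, 0, 0, 0) = 0"
  "coeff4 (fps_const (fps_const fps_X)) (0, 0, 0, 0) = 0"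
  "coeff4 (fps_const fps_X) (0, 0, 0, 0) = 0"
  "coeff4 fps_X (0, 0, 0, 0) = 0"
  by (simp_all add: coeff4_def)

lemma to_fract_power: "to_fract (x ^ n) = to_fract x ^ n"
  by (induction n) auto

text \<open>No positive power of q is 1 for degree reasons, and the products involving a, ..., d
  have constant term 0, hence differ from 1.\<close>

lemma AW_generic_strict_vars: "AW_generic_strict var_q var_a var_b var_c var_d"
proof
  fix n :: nat assume n: "n > 0"
  have "monom 1 1 ^ n = (monom 1 n :: rat poly)"
    by (induction n) (simp_all add: mult_monom)
  then have "(monom 1 1 ^ n :: rat poly) \<noteq> 1"
    using n degree_monom_eq[of "1::rat" n] by auto
  then have "to_fract (monom 1 1) ^ n \<noteq> (1 :: rat_q)"
    by (simp flip: to_fract_power to_fract_1)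
  then have "const4 (to_fract (monom 1 1)) ^ n \<noteq> 1"
    using coeff4_const4[of "to_fract (monom 1 1) ^ n"] coeff4_const4[of 1]
    by (metis const4_power const4_simps(3))
  then show "var_q ^ n \<noteq> 1"
    by (simp add: var_conv of_pow4_eq_to_fract flip: to_fract_power to_fract_1)
next
  show "var_q \<noteq> 0" "var_a \<noteq> 0" "(2::aw_coef) \<noteq> 0"
    by (simp_all only: var_nonzero aw_coef_two not_False_eq_True)
next
  fix i
  have *: "of_pow4 f * of_pow4 g = of_pow4 (f * g)" "of_pow4 f ^ n = of_pow4 (f ^ n)" for f g n
    by (simp_all add: of_pow4_eq_to_fract to_fract_power)
  show "var_a * var_b * var_c * var_d * var_q ^ i \<noteq> 1" "var_a * var_b * var_q ^ i \<noteq> 1"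
    "var_a * var_c * var_q ^ i \<noteq> 1" "var_a * var_d * var_q ^ i \<noteq> 1"
    unfolding var_conv * by (rule of_pow4_neq_1, simp only: coeff4_0_mult coeff4_vars mult_zero_left mult_zero_right)+
qed

interpretation AW_generic_strict var_q var_a var_b var_c var_d
  by (rule AW_generic_strict_vars)

lemma d_divisible_var_d_power: "d_divisible N (var_d ^ N)"
  unfolding d_divisible_def var_conv of_pow4_eq_to_fract to_fract_power[symmetric]
  by (rule exI[of _ 1]) simp

lemma d_divisible_abcd_power: "d_divisible N ((var_a * var_b * var_c * var_d * var_q ^ i) ^ N)"
  unfolding power_mult_distrib[of _ "var_q ^ i"] power_mult_distrib[of _ var_d]
  by (intro d_divisible_mult_left d_divisible_mult_right d_divisible_var_d_power integral4_power
      integral4_mult integral4_vars)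

text \<open>The positive power of abcd absorbs 1/a; this is why the weights with a negative power of
  a are still power series.\<close>

lemma d_divisible_abcd_power_div_a:
  "d_divisible (Suc N) ((var_a * var_b * var_c * var_d * var_q ^ i) ^ Suc N / var_a)"
proof -
  have "(var_a * var_b * var_c * var_d * var_q ^ i) ^ Suc N / var_a =
      var_a ^ N * (var_b * var_c * var_q ^ i) ^ Suc N * var_d ^ Suc N"
    using var_nonzero by (simp add: power_mult_distrib)
  also have "d_divisible (Suc N) \<dots>"
    by (intro d_divisible_mult_right d_divisible_var_d_power integral4_power integral4_mult integral4_vars)
  finally show ?thesis .
qed

lemma integral4_half [intro]: "integral4 x \<Longrightarrow> integral4 (x / 2)"
  by (metis divide_inverse integral4_inverse_2 integral4_mult)

lemmas integral4_intros = integral4_mult integral4_diff integral4_power integral4_vars integral4_inverse_q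
  integral4_inverse_2 integral4_half integral4_q_powi integral4_div_q_power integral4_1 d_divisible_uminus
  d_divisible_add

text \<open>The exponent is the number m of the period containing level t, and it is 0 for t < 3 by
  truncated subtraction. A factor 1/a occurs only for r = 0 and m > 0.\<close>

lemma d_divisible_weight:
  "d_divisible ((t - 3) div 8) (w_AW var_a var_b var_c var_d var_q t i j)"
proof (cases "t < 3")
  case True
  then consider "t = 0" | "t = 1" | "t = 2" by linarith
  then have "integral4 (w_AW var_a var_b var_c var_d var_q t i j)"
    by cases (auto simp: w_AW_def simp del: minus_divide_left intro!: integral4_intros)
  then show ?thesis using True by simp
next
  case False
  define m r where "m = (t - 3) div 8" and "r = (t - 3) mod 8"
  let ?s = "(var_a * var_b * var_c * var_d * var_q ^ (2 * i)) ^ m"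
  have t: "w_AW var_a var_b var_c var_d var_q t i j = w_AWH var_a var_b var_c var_d var_q (8 * m + r) i j"
    using False by (simp add: w_AW_def m_def r_def)
  have r: "r < 8" by (simp add: r_def)
  show ?thesis
  proof (cases "r = 0 \<and> m \<noteq> 0")
    case True
    then obtain m' where m': "m = Suc m'" by (cases m) auto
    have w: "w_AWH var_a var_b var_c var_d var_q (8 * m + r) i j =
        ?s / var_a * (inverse 2 * (var_q ^ j * - (var_q powi (- int i))))"
      unfolding w_AWH_block[OF r] using True by (simp add: inverse_eq_divide mult_ac)
    show ?thesis
      unfolding t w m_def[symmetric] unfolding m'
      by (intro d_divisible_mult_left d_divisible_abcd_power_div_a integral4_intros)
  next
    case False
    let ?x = "if r = 0 then var_a else if r = 1 then var_b else if r = 2 then var_c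
       else if r = 3 then - var_a * var_b * var_c * var_q ^ i
       else if r = 4 then var_d
       else if r = 5 then - var_a * var_b * var_d * var_q ^ i
       else if r = 6 then - var_a * var_c * var_d * var_q ^ i
       else var_a ^ 2 * var_b * var_c * var_d * var_q ^ (2 * i)"
    have "w_AWH var_a var_b var_c var_d var_q (8 * m + r) i j = ?s * (inverse 2 * (var_q ^ j * ?x))"
      unfolding w_AWH_block[OF r] using False by (cases "r = 0") (simp_all add: inverse_eq_divide)
    moreover have "integral4 ?x"
      by (auto intro!: integral4_intros)
    ultimately show ?thesis
      unfolding t m_def[symmetric]
      by (simp only:) (intro d_divisible_mult_left d_divisible_abcd_power integral4_intros)
  qed
qed

lemma d_divisible_block_weight:
  "d_divisible (Suc m) (block_weight var_a var_b var_c var_d var_q (Suc m) i)"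
proof -
  have "block_weight var_a var_b var_c var_d var_q (Suc m) i =
      (var_a * var_b * var_c * var_d * var_q ^ (2 * i)) ^ Suc m / var_a *
      (- (inverse 2 / var_q ^ i) * (1 - var_a * var_b * var_q ^ i) * (1 - var_a * var_c * var_q ^ i) *
        (1 - var_a * var_d * var_q ^ i))"
    by (simp add: block_weight_def inverse_eq_divide)
  also have "d_divisible (Suc m) \<dots>"
    by (intro d_divisible_mult_left d_divisible_abcd_power_div_a integral4_intros)
  finally show ?thesis .
qed

text \<open>Each factor has the form 1 - d f with a power series f, hence is invertible.\<close>

lemma integral4_inverse_qpoch:
  "integral4 (inverse (qpoch (var_a * var_b * var_c * var_d * var_q ^ k) var_q n))"
proof -
  have "integral4 (inverse (1 - var_a * var_b * var_c * var_d * var_q ^ k * var_q ^ i))" for i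
  proof -
    have "integral4 (var_a * var_b * var_c * var_q ^ k * var_q ^ i)"
      by (intro integral4_intros)
    then obtain f where f: "var_a * var_b * var_c * var_q ^ k * var_q ^ i = of_pow4 f"
      by (auto simp: integral4_iff)
    define g where "g = 1 - fps_X * f"
    have "1 - var_a * var_b * var_c * var_d * var_q ^ k * var_q ^ i =
        1 - var_d * (var_a * var_b * var_c * var_q ^ k * var_q ^ i)"
      by (simp add: mult_ac)
    also have "\<dots> = of_pow4 g"
      unfolding f g_def by (simp add: var_conv of_pow4_eq_to_fract)
    finally have g: "1 - var_a * var_b * var_c * var_d * var_q ^ k * var_q ^ i = of_pow4 g" .
    have "g * fps_right_inverse g 1 = 1"
      by (rule fps_right_inverse) (simp add: g_def)
    then have "of_pow4 g * of_pow4 (fps_right_inverse g 1) = 1"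
      unfolding of_pow4_eq_to_fract by (simp flip: to_fract_mult)
    then show ?thesis
      unfolding g by (metis inverse_unique integral4_of_pow4)
  qed
  then show ?thesis
    unfolding qpoch_def prod_inversef[symmetric, unfolded comp_def] by auto
qed

text \<open>Below the diagonal the product of block weights is nonempty, so one factor provides the
  power of d.\<close>

lemma d_divisible_Zmat:
  assumes "k < j"
  shows "d_divisible (Suc m) (entry (Zmat var_q (var_a * var_b * var_c * var_d)
    (block_weight var_a var_b var_c var_d var_q (Suc m))) j k)"
proof -
  have "d_divisible (Suc m) (\<Prod>i = k..<j. block_weight var_a var_b var_c var_d var_q (Suc m) i)"
    by (rule d_divisible_prod[of _ k])
       (use assms d_divisible_block_weight in \<open>auto intro: d_divisible_mono\<close>)
  then show ?thesis
    unfolding Zmat.rep_eq divide_inverse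
    by (rule d_divisible_mult_left[OF d_divisible_mult_right[OF integral4_qbin[OF integral4_vars(5)]]
          integral4_inverse_qpoch])
qed

text \<open>The difference is L (Z - 1), where L is the level product and Z - 1 is divisible by
  d^(m+1).\<close>

lemma d_divisible_AW_moments_diff:
  assumes "\<And>n k. integral4 (entry (level_prod var_a var_b var_c var_d var_q (8 * m + 11)) n k)"
  shows "d_divisible (Suc m) (entry (AW_moments var_a var_b var_c var_d var_q) n k -
    entry (level_prod var_a var_b var_c var_d var_q (8 * m + 11)) n k)"
proof -
  let ?L = "entry (level_prod var_a var_b var_c var_d var_q (8 * m + 11))"
  let ?Z = "entry (Zmat var_q (var_a * var_b * var_c * var_d)
    (block_weight var_a var_b var_c var_d var_q (Suc m)))"
  have "entry (AW_moments var_a var_b var_c var_d var_q) n k = (\<Sum>j\<le>n. ?L n j * ?Z j k)"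
    unfolding AW_moments_eq_level_prod[of m] entry_mult ..
  moreover have "?L n k = (\<Sum>j\<le>n. ?L n j * entry 1 j k)"
    using entry_mult[of "level_prod var_a var_b var_c var_d var_q (8 * m + 11)" 1 n k] by simp
  ultimately have "entry (AW_moments var_a var_b var_c var_d var_q) n k - ?L n k =
      (\<Sum>j\<le>n. ?L n j * (?Z j k - entry 1 j k))"
    by (simp add: right_diff_distrib sum_subtractf)
  also have "d_divisible (Suc m) \<dots>"
  proof (intro d_divisible_sum d_divisible_mult_right assms)
    fix j
    consider "k < j" | "k = j" | "j < k" by linarith
    then show "d_divisible (Suc m) (?Z j k - entry 1 j k)"
    proof cases
      case 1
      then show ?thesis using d_divisible_Zmat[OF 1] by (simp add: entry_one)
    qed (simp_all add: entry_one entry_eq_0 Zmat.rep_eq qbin_eq_0)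
  qed
  finally show ?thesis .
qed

section \<open>Summation over all paths\<close>

lemma path_weight_of_pow4:
  "path_weight (\<lambda>t i j. of_pow4 (w t i j)) p = of_pow4 (path_weight w p)"
proof -
  have "of_pow4 (prod f A) = (\<Prod>x\<in>A. of_pow4 (f x))" for f and A :: "(nat \<times> nat \<times> nat) set"
    unfolding of_pow4_eq_to_fract by (induction A rule: infinite_finite_induct) auto
  then show ?thesis
    unfolding path_weight_def by (simp add: case_prod_unfold)
qed

text \<open>For a monomial with d-exponent ed, all but finitely many paths have weight divisible by
  d^(ed+1). The remaining paths sum to a level product, which agrees with the moments modulo
  d^(ed+1).\<close>

lemma has_formal_sum_AW:
  "has_formal_sum (path_weight (w_AW var_a var_b var_c var_d var_q)) (SE_paths k n)
    (entry (AW_moments var_a var_b var_c var_d var_q) n k)"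
proof -
  let ?w = "w_AW var_a var_b var_c var_d var_q"
  let ?M = "entry (AW_moments var_a var_b var_c var_d var_q) n k"
  let ?L = "\<lambda>T. level_prod var_a var_b var_c var_d var_q T"
  obtain v where v: "\<And>t i j. ?w t i j = of_pow4 (fps_X ^ ((t - 3) div 8) * v t i j)"
    using d_divisible_weight unfolding d_divisible_def by metis
  define w where "w t i j = fps_X ^ ((t - 3) div 8) * v t i j" for t i j
  have "?w = (\<lambda>t i j. of_pow4 (w t i j))"
    by (intro ext) (simp add: v w_def)
  then have weight: "path_weight ?w p = of_pow4 (path_weight w p)" for p
    by (simp add: path_weight_of_pow4)
  have of_pow4_sum: "of_pow4 (sum f A) = (\<Sum>x\<in>A. of_pow4 (f x))" for f and A :: "(nat \<Rightarrow> nat \<times> real) set"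
    by (simp add: of_pow4_eq_to_fract)
  have L: "entry (?L T) n' k' = of_pow4 (\<Sum>p\<in>low_paths T k' (lh_vertex 0 n' 0). path_weight w p)" for T n' k'
    unfolding low_sum_eq_level_prod[symmetric] low_sum_def weight of_pow4_sum ..
  have diff: "d_divisible (Suc m) (?M - entry (?L (8 * m + 11)) n k)" for m
    by (rule d_divisible_AW_moments_diff) (auto simp: L)
  \<comment> \<open>The moment is a power series because it differs by one from a finite sum of path
    weights.\<close>
  have "integral4 (?M - entry (?L 11) n k + entry (?L 11) n k)"
    using d_divisible_mono[OF diff[of 0]] by (intro d_divisible_add) (auto simp: L)
  then obtain r where r: "?M = of_pow4 r"
    by (auto simp: integral4_iff)
  have "finite {p \<in> SE_paths k n. coeff4 (path_weight w p) e \<noteq> 0} \<and>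
      coeff4 r e = (\<Sum>p | p \<in> SE_paths k n \<and> coeff4 (path_weight w p) e \<noteq> 0. coeff4 (path_weight w p) e)" for e
  proof -
    obtain ea eb ec ed where e: "e = (ea, eb, ec, ed)" by (metis prod_cases4)
    \<comment> \<open>The bound 8 ed + 11 is the least T such that t \<ge> T forces (t - 3) div 8 >
      ed; it is also the length of the level product in \<open>diff\<close>.\<close>
    define P where "P = low_paths (8 * ed + 11) k (lh_vertex 0 n 0)"
    have "finite P"
      unfolding P_def by (rule finite_low_paths) simp
    have zero: "coeff4 (path_weight w p) e = 0" if pS: "p \<in> SE_paths k n" and pP: "p \<notin> P" for p
    proof -
      have p: "p \<in> paths_from k (lh_vertex 0 n 0)"
        using pS by (simp add: SE_paths_eq_paths_from)
      then obtain t i j where tij: "(t, i, j) \<in> east_steps p" "\<not> t < 8 * ed + 11"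
        using pP by (auto simp: P_def low_paths_def)
      define N where "N = (t - 3) div 8"
      have "ed < N" using tij(2) by (simp add: N_def)
      have "path_weight w p = w t i j * (\<Prod>(t, i, j)\<in>east_steps p - {(t, i, j)}. w t i j)"
        unfolding path_weight_eq using prod.remove[OF finite_east_steps[OF p] tij(1), of "\<lambda>(t, i, j). w t i j"]
        by simp
      then show ?thesis
        unfolding e w_def[of t i j] N_def[symmetric] mult.assoc
        by (simp add: coeff4_X_power_mult[OF \<open>ed < N\<close>])
    qed
    have PS: "P \<subseteq> SE_paths k n"
      by (auto simp: P_def low_paths_def SE_paths_eq_paths_from)
    have sub: "{p \<in> SE_paths k n. coeff4 (path_weight w p) e \<noteq> 0} \<subseteq> P"
      using zero by blast
    obtain f where "?M - entry (?L (8 * ed + 11)) n k = of_pow4 (fps_X ^ Suc ed * f)"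
      using diff[of ed] by (auto simp: d_divisible_def)
    then have "of_pow4 (r - (\<Sum>p\<in>P. path_weight w p)) = of_pow4 (fps_X ^ Suc ed * f)"
      unfolding r L P_def[symmetric] by (simp add: of_pow4_eq_to_fract)
    then have "r = fps_X ^ Suc ed * f + (\<Sum>p\<in>P. path_weight w p)"
      unfolding of_pow4_eq_to_fract to_fract_eq_iff by (simp add: algebra_simps)
    then have "coeff4 r e = (\<Sum>p\<in>P. coeff4 (path_weight w p) e)"
      unfolding e by (simp add: coeff4_add coeff4_sum coeff4_X_power_mult del: power_Suc)
    also have "\<dots> = (\<Sum>p | p \<in> SE_paths k n \<and> coeff4 (path_weight w p) e \<noteq> 0. coeff4 (path_weight w p) e)"
      by (rule sum.mono_neutral_right[OF \<open>finite P\<close> sub]) (use PS in auto)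
    finally show ?thesis
      using finite_subset[OF sub \<open>finite P\<close>] by blast
  qed
  then show ?thesis
    unfolding has_formal_sum_def
    by (intro exI[of _ "path_weight w"] exI[of _ r]) (simp add: weight r)
qed

text \<open>Injectivity of \<open>of_pow4\<close> makes the lifted family, and with it every
  coefficient of the sum, unique.\<close>

lemma has_formal_sum_unique:
  assumes "has_formal_sum f A s" "has_formal_sum f A s'"
  shows "s = s'"
proof -
  obtain g r where g: "\<And>x. x \<in> A \<Longrightarrow> f x = of_pow4 (g x)" "s = of_pow4 r"
    "\<And>e. coeff4 r e = (\<Sum>x | x \<in> A \<and> coeff4 (g x) e \<noteq> 0. coeff4 (g x) e)"
    using assms(1) unfolding has_formal_sum_def by blast
  obtain g' r' where g': "\<And>x. x \<in> A \<Longrightarrow> f x = of_pow4 (g' x)" "s' = of_pow4 r'"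
    "\<And>e. coeff4 r' e = (\<Sum>x | x \<in> A \<and> coeff4 (g' x) e \<noteq> 0. coeff4 (g' x) e)"
    using assms(2) unfolding has_formal_sum_def by blast
  have "g x = g' x" if "x \<in> A" for x
    using g(1)[OF that] g'(1)[OF that] by (simp add: of_pow4_eq_to_fract)
  then have "coeff4 r e = coeff4 r' e" for e
    unfolding g(3) g'(3) by (intro sum.cong) auto
  then show ?thesis
    unfolding g(2) g'(2) by (metis coeff4_eqI)
qed

theorem theorem5p7:
  fixes n k :: nat
  assumes "k \<le> n"
  shows "formally_summable (path_weight (w_AW var_a var_b var_c var_d var_q)) (SE_paths k n) \<and>
    lh_h (w_AW var_a var_b var_c var_d var_q) n k = sigma_AW n k var_a var_b var_c var_d var_q"
proof
  show "formally_summable (path_weight (w_AW var_a var_b var_c var_d var_q)) (SE_paths k n)"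
    using has_formal_sum_AW by (auto simp: formally_summable_def)
  show "lh_h (w_AW var_a var_b var_c var_d var_q) n k = sigma_AW n k var_a var_b var_c var_d var_q"
    unfolding lh_h_def formal_sum_def sigma_AW_eq[OF AW_generic_strict_vars]
    by (rule the_equality) (blast intro: has_formal_sum_AW has_formal_sum_unique)+
qed

end
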